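(* Let $r\ge 1$ and $n$ be integers, let $[\lambda(j)]=[\lambda(1),\ldots,\lambda(r)]$ be an $r$-multipartition of $n$, and let $\mu$ be a partition of $n$ with $\ell(\mu)=l$. Then $K_{[\lambda(j)]\mu}=1$ if and only if there exists a choice of indices $0=i_0<i_1<\cdots<i_t=l$ such that, for each $k=1,\ldots,t$, the $r$-multipartition $[\lambda(j)^k]$ defined by $$\lambda(j)^k=(\lambda(j)_{i_{k-1}+1},\lambda(j)_{i_{k-1}+2},\ldots,\lambda(j)_{i_k}),\qquad 1\le j\le r,$$ where $\lambda(j)_i=0$ if $i>\ell(\lambda(j))$, and the partition $\mu^k=(\mu_{i_{k-1}+1},\mu_{i_{k-1}+2},\ldots,\mu_{i_k})$, satisfy the following: (1) $\widetilde{\lambda^k}\unrhd\mu^k$, where $\widetilde{\lambda^k}$ is the partition with parts $\widetilde{\lambda^k}_i=\sum_{j=1}^r\lambda(j)^k_i$; and (2) for at most one $j$, either $\lambda(j)_{i_{k-1}+1}=\lambda(j)_{i_{k-1}+2}=\cdots=\lambda(j)_{i_k-1}>\lambda(j)_{i_k}$ or $\lambda(j)_{i_{k-1}+1}>\lambda(j)_{i_{k-1}+2}=\lambda(j)_{i_{k-1}+3}=\cdots=\lambda(j)_{i_k}$, and for all other $j$, $\lambda(j)_{i_{k-1}+1}=\lambda(j)_{i_{k-1}+2}=\cdots=\lambda(j)_{i_k-1}=\lambda(j)_{i_k}$.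
   Context: A partition $\lambda=(\lambda_1\ge\lambda_2\ge\cdots\ge\lambda_l>0)$ has length $\ell(\lambda)=l$ and size $|\lambda|=\sum_i\lambda_i$; set $\lambda_i=0$ for $i>\ell(\lambda)$ (trailing zeros are ignored; the empty partition is allowed). For partitions $\lambda,\mu$ of the same size, $\lambda\unrhd\mu$ (dominance) means $\sum_{i\le m}\lambda_i\ge\sum_{i\le m}\mu_i$ for all $m\ge1$; the relation $\unrhd$ is only considered between partitions of the same size, so asserting it includes equality of sizes. A semistandard Young tableau of shape $\lambda$ is a filling of the Young diagram of $\lambda$ (left-justified rows of lengths $\lambda_1,\lambda_2,\ldots$ from top to bottom) by positive integers, weakly increasing along rows from left to right and strictly increasing down columns. Its weight is the sequence $\omega$ with $\omega_i$ the number of entries equal to $i$. An $r$-multipartition of $n$ is a sequence $[\lambda(j)]=[\lambda(1),\ldots,\lambda(r)]$ of partitions with $\sum_{j=1}^r|\lambda(j)|=n$. A semistandard Young $r$-multitableau of shape $[\lambda(j)]$ and weight $\omega$ is a sequence $[T(j)]=[T(1),\ldots,T(r)]$ of semistandard Young tableaux, $T(j)$ of shape $\lambda(j)$ and weight $\omega(j)$, such that $\omega_i=\sum_{j=1}^r\omega(j)_i$ for all $i$. $K_{[\lambda(j)]\omega}$ is the number of semistandard Young $r$-multitableaux of shape $[\lambda(j)]$ and weight $\omega$. In condition (2), when $i_k=i_{k-1}+1$ each $\lambda(j)^k$ has a single entry, and the "all equal" condition holds trivially for every $j$. *)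

theory Defs
  imports Main
begin

text \<open>
  A partition is represented by its infinite sequence of parts, padded with zeros; this makes
  the convention about trailing zeros part of the encoding. Indices start at 0, so
  \<open>\<alpha> i\<close> stands for the part written \<open>\<alpha>\<^sub>i\<^sub>+\<^sub>1\<close> in the usual 1-based numbering.
\<close>

definition is_partition :: "(nat \<Rightarrow> nat) \<Rightarrow> bool" where
  "is_partition \<alpha> \<longleftrightarrow> antimono \<alpha> \<and> finite {i. \<alpha> i \<noteq> 0}"

definition psize :: "(nat \<Rightarrow> nat) \<Rightarrow> nat" where
  "psize \<alpha> = (\<Sum>i | \<alpha> i \<noteq> 0. \<alpha> i)"

definition plength :: "(nat \<Rightarrow> nat) \<Rightarrow> nat" where
  "plength \<alpha> = card {i. \<alpha> i \<noteq> 0}"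

definition dominates :: "(nat \<Rightarrow> nat) \<Rightarrow> (nat \<Rightarrow> nat) \<Rightarrow> bool" (infix "\<unrhd>" 50) where
  "\<alpha> \<unrhd> \<mu> \<longleftrightarrow> psize \<alpha> = psize \<mu> \<and> (\<forall>m. (\<Sum>i<m. \<alpha> i) \<ge> (\<Sum>i<m. \<mu> i))"

definition is_multipartition :: "nat \<Rightarrow> (nat \<Rightarrow> nat) list \<Rightarrow> bool" where
  "is_multipartition n \<Lambda> \<longleftrightarrow>
     (\<forall>\<alpha> \<in> set \<Lambda>. is_partition \<alpha>) \<and> (\<Sum>\<alpha>\<leftarrow>\<Lambda>. psize \<alpha>) = n"

text \<open>
  A tableau is a function of the row and column index (both from 0). Its entries are positive
  on the diagram, and it is required to be 0 off the diagram, so that distinct functions are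
  distinct fillings and tableaux can be counted.
\<close>

definition diagram :: "(nat \<Rightarrow> nat) \<Rightarrow> (nat \<times> nat) set" where
  "diagram \<alpha> = {(i, c). c < \<alpha> i}"

definition semistandard :: "(nat \<Rightarrow> nat) \<Rightarrow> (nat \<Rightarrow> nat \<Rightarrow> nat) \<Rightarrow> bool" where
  "semistandard \<alpha> T \<longleftrightarrow>
     (\<forall>i c. (i, c) \<in> diagram \<alpha> \<longrightarrow> T i c \<ge> 1) \<and>
     (\<forall>i c. (i, c) \<notin> diagram \<alpha> \<longrightarrow> T i c = 0) \<and>
     (\<forall>i c d. c < d \<and> (i, c) \<in> diagram \<alpha> \<and> (i, d) \<in> diagram \<alpha> \<longrightarrow> T i c \<le> T i d) \<and>
     (\<forall>i j c. i < j \<and> (i, c) \<in> diagram \<alpha> \<and> (j, c) \<in> diagram \<alpha> \<longrightarrow> T i c < T j c)"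

text \<open>Weights are indexed from 0 like partitions: position \<open>i\<close> counts the entries \<open>i + 1\<close>.\<close>

definition weight :: "(nat \<Rightarrow> nat) \<Rightarrow> (nat \<Rightarrow> nat \<Rightarrow> nat) \<Rightarrow> nat \<Rightarrow> nat" where
  "weight \<alpha> T i = card {(a, c) \<in> diagram \<alpha>. T a c = i + 1}"

definition multitableaux ::
    "(nat \<Rightarrow> nat) list \<Rightarrow> (nat \<Rightarrow> nat) \<Rightarrow> (nat \<Rightarrow> nat \<Rightarrow> nat) list set" where
  "multitableaux \<Lambda> \<omega> =
     {Ts. length Ts = length \<Lambda> \<and>
          (\<forall>j < length \<Lambda>. semistandard (\<Lambda> ! j) (Ts ! j)) \<and>
          (\<forall>i. \<omega> i = (\<Sum>j < length \<Lambda>. weight (\<Lambda> ! j) (Ts ! j) i))}"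

definition multi_kostka :: "(nat \<Rightarrow> nat) list \<Rightarrow> (nat \<Rightarrow> nat) \<Rightarrow> nat" where
  "multi_kostka \<Lambda> \<omega> = card (multitableaux \<Lambda> \<omega>)"

text \<open>The block with 0-based indices \<open>p, \<dots>, q - 1\<close>, i.e. 1-based indices \<open>p + 1, \<dots>, q\<close>.\<close>

definition block :: "nat \<Rightarrow> nat \<Rightarrow> (nat \<Rightarrow> nat) \<Rightarrow> (nat \<Rightarrow> nat)" where
  "block p q \<alpha> = (\<lambda>i. if p + i < q then \<alpha> (p + i) else 0)"

definition sum_parts :: "(nat \<Rightarrow> nat) list \<Rightarrow> (nat \<Rightarrow> nat)" where
  "sum_parts \<Lambda> = (\<lambda>i. \<Sum>j < length \<Lambda>. (\<Lambda> ! j) i)"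

definition all_equal :: "nat \<Rightarrow> nat \<Rightarrow> (nat \<Rightarrow> nat) \<Rightarrow> bool" where
  "all_equal p q \<alpha> \<longleftrightarrow> (\<forall>i \<in> {p..<q}. \<alpha> i = \<alpha> p)"

text \<open>
  The chains \<open>\<alpha> p = \<dots> = \<alpha> (q - 2) > \<alpha> (q - 1)\<close> and \<open>\<alpha> p > \<alpha> (p + 1) = \<dots> = \<alpha> (q - 1)\<close>.
  They make sense only for blocks with at least two entries, whence the guard; a block with
  a single entry counts as constant.
\<close>

definition last_smaller :: "nat \<Rightarrow> nat \<Rightarrow> (nat \<Rightarrow> nat) \<Rightarrow> bool" where
  "last_smaller p q \<alpha> \<longleftrightarrow> p + 2 \<le> q \<and> all_equal p (q - 1) \<alpha> \<and> \<alpha> (q - 2) > \<alpha> (q - 1)"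

definition first_larger :: "nat \<Rightarrow> nat \<Rightarrow> (nat \<Rightarrow> nat) \<Rightarrow> bool" where
  "first_larger p q \<alpha> \<longleftrightarrow> p + 2 \<le> q \<and> \<alpha> p > \<alpha> (p + 1) \<and> all_equal (p + 1) q \<alpha>"

definition at_most_one_jump :: "nat \<Rightarrow> nat \<Rightarrow> (nat \<Rightarrow> nat) list \<Rightarrow> bool" where
  "at_most_one_jump p q \<Lambda> \<longleftrightarrow>
     (let J = {j. j < length \<Lambda> \<and> (last_smaller p q (\<Lambda> ! j) \<or> first_larger p q (\<Lambda> ! j))}
      in card J \<le> 1 \<and> (\<forall>j < length \<Lambda>. j \<notin> J \<longrightarrow> all_equal p q (\<Lambda> ! j)))"

end

theory Submission
  imports Defs
begin

text \<open>
  A semistandard tableau is the same thing as a Gelfand-Tsetlin pattern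
  \<open>g i v = card {c. c < \<alpha> i \<and> T i c \<le> v}\<close>, and a weight prescribes, at every level \<open>v\<close>, the sum
  of the entries of all patterns of a multitableau.

  If the blocks are as described, equality of the prefix sums at the ends of a block confines its
  rows to its own letters. The interlacing inequalities then determine all entries at a level
  except possibly one, which is given by the weight.

  Conversely, cut at all positions where the prefix sums agree. In a block with strict inequalities
  inside, consider the shape left after deleting the last letter. If it is the only admissible one,
  no box can be exchanged between two of its row ends, and this leaves room for only one pair
  of consecutive unequal rows in all components together. That pair becomes two such pairs in the
  remaining shape, which has the same properties, unless it involves the first or the last row.
\<close>

subsection \<open>Patterns and prefix sums\<close>

text \<open>The inequality between neighbouring rows is column strictness: a cell with entry at most
  \<open>v + 1\<close> lies below a cell with entry at most \<open>v\<close>. Making every level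
  from \<open>m\<close> on equal to the shape bounds the letters by \<open>m\<close> and leaves one
  pattern per tableau.\<close>

definition gt_pattern :: "nat \<Rightarrow> (nat \<Rightarrow> nat) \<Rightarrow> (nat \<Rightarrow> nat \<Rightarrow> nat) \<Rightarrow> bool" where
  "gt_pattern m \<alpha> g \<longleftrightarrow>
     (\<forall>i. g i 0 = 0) \<and> (\<forall>i v. g i v \<le> g i (Suc v)) \<and>
     (\<forall>i v. g (Suc i) (Suc v) \<le> g i v) \<and> (\<forall>i v. m \<le> v \<longrightarrow> g i v = \<alpha> i)"

definition psum :: "nat \<Rightarrow> (nat \<Rightarrow> nat \<Rightarrow> nat) \<Rightarrow> nat \<Rightarrow> nat" where
  "psum r A k = (\<Sum>i<k. \<Sum>j<r. A j i)"

text \<open>Only the first \<open>v\<close> rows are summed at level \<open>v\<close> because the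
  others are empty there (\<open>gt_pattern_eq_0\<close>). Cumulative counts take the place of the
  weight since they compare directly with dominance.\<close>

definition multi_pattern ::
    "nat \<Rightarrow> nat \<Rightarrow> (nat \<Rightarrow> nat \<Rightarrow> nat) \<Rightarrow> (nat \<Rightarrow> nat) \<Rightarrow> (nat \<Rightarrow> nat \<Rightarrow> nat \<Rightarrow> nat) \<Rightarrow> bool" where
  "multi_pattern r m A \<mu> G \<longleftrightarrow>
     (\<forall>j<r. gt_pattern m (A j) (G j)) \<and>
     (\<forall>v\<le>m. psum r (\<lambda>j i. G j i v) v = (\<Sum>i<v. \<mu> i))"

text \<open>Uniqueness is kept apart from existence. It is asked only for \<open>j < r\<close>
  because a multi-pattern leaves the other components arbitrary.\<close>

definition unique_pattern :: "nat \<Rightarrow> nat \<Rightarrow> (nat \<Rightarrow> nat \<Rightarrow> nat) \<Rightarrow> (nat \<Rightarrow> nat) \<Rightarrow> bool" where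
  "unique_pattern r m A \<mu> \<longleftrightarrow>
     (\<forall>G H. multi_pattern r m A \<mu> G \<longrightarrow> multi_pattern r m A \<mu> H \<longrightarrow> (\<forall>j<r. G j = H j))"

text \<open>Dominance of the summed shape over \<open>\<mu>\<close>, together with the bound of
  \<open>m\<close> rows that column strictness imposes when there are \<open>m\<close>
  letters.\<close>

definition dominating :: "nat \<Rightarrow> nat \<Rightarrow> (nat \<Rightarrow> nat \<Rightarrow> nat) \<Rightarrow> (nat \<Rightarrow> nat) \<Rightarrow> bool" where
  "dominating r m A \<mu> \<longleftrightarrow>
     (\<forall>j<r. antimono (A j) \<and> (\<forall>i\<ge>m. A j i = 0)) \<and>
     (\<forall>k\<le>m. (\<Sum>i<k. \<mu> i) \<le> psum r A k) \<and> psum r A m = (\<Sum>i<m. \<mu> i)"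

text \<open>The cells between \<open>B\<close> and \<open>A\<close> form a horizontal strip in each
  component, as the occurrences of the largest letter do.\<close>

definition interlacing :: "nat \<Rightarrow> (nat \<Rightarrow> nat \<Rightarrow> nat) \<Rightarrow> (nat \<Rightarrow> nat \<Rightarrow> nat) \<Rightarrow> bool" where
  "interlacing r A B \<longleftrightarrow> (\<forall>j<r. \<forall>i. A j (Suc i) \<le> B j i \<and> B j i \<le> A j i)"

section \<open>Elementary properties of a single pattern\<close>

lemma gt_pattern_mono:
  assumes "gt_pattern m \<alpha> g" "v \<le> w"
  shows "g i v \<le> g i w"
  using assms(1) lift_Suc_mono_le[of "g i" v w] assms(2) unfolding gt_pattern_def by blast

lemma gt_pattern_le:
  assumes "gt_pattern m \<alpha> g"
  shows "g i v \<le> \<alpha> i"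
proof -
  have "g i v \<le> g i (max m v)" by (rule gt_pattern_mono[OF assms]) simp
  also have "\<dots> = \<alpha> i" using assms unfolding gt_pattern_def by simp
  finally show ?thesis .
qed

lemma gt_pattern_diagonal:
  assumes "gt_pattern m \<alpha> g"
  shows "g (i + d) (v + d) \<le> g i v"
proof (induction d)
  case (Suc d)
  have "g (Suc (i + d)) (Suc (v + d)) \<le> g (i + d) (v + d)"
    using assms unfolding gt_pattern_def by blast
  then show ?case using Suc by simp
qed simp

text \<open>Follow the diagonal down to level 0, where every row is empty. In tableau terms, column
  strictness makes all entries of row \<open>i\<close> exceed \<open>i\<close>.\<close>

lemma gt_pattern_eq_0:
  assumes "gt_pattern m \<alpha> g" "v \<le> i"
  shows "g i v = 0"
proof -
  have "g (i - v + v) (0 + v) \<le> g (i - v) 0" by (rule gt_pattern_diagonal[OF assms(1)])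
  then show ?thesis using assms unfolding gt_pattern_def by simp
qed

section \<open>Arithmetic of prefix sums\<close>

lemma psum_Suc: "psum r A (Suc k) = psum r A k + (\<Sum>j<r. A j k)"
  by (simp add: psum_def)

lemma psum_0 [simp]: "psum r A 0 = 0"
  by (simp add: psum_def)

lemma psum_cong:
  assumes "\<And>j i. j < r \<Longrightarrow> i < k \<Longrightarrow> A j i = B j i"
  shows "psum r A k = psum r B k"
  unfolding psum_def by (intro sum.cong) (simp_all add: assms)

lemma psum_mono:
  assumes "\<And>j i. j < r \<Longrightarrow> i < k \<Longrightarrow> A j i \<le> B j i"
  shows "psum r A k \<le> psum r B k"
  unfolding psum_def by (intro sum_mono) (simp add: assms)

lemma psum_eq_imp_eq:
  assumes le: "\<And>j i. j < r \<Longrightarrow> i < k \<Longrightarrow> A j i \<le> B j i"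
    and eq: "psum r B k \<le> psum r A k" and j: "j < r" and i: "i < k"
  shows "A j i = B j i"
proof (rule ccontr)
  assume "A j i \<noteq> B j i"
  then have "A j i < B j i" using le j i by (metis le_neq_implies_less)
  then have "(\<Sum>j<r. A j i) < (\<Sum>j<r. B j i)"
    using le j i by (intro sum_strict_mono_ex1) auto
  then have "psum r A k < psum r B k"
    unfolding psum_def using le i by (intro sum_strict_mono_ex1) (auto intro!: sum_mono)
  then show False using eq by simp
qed

text \<open>The old and the new row length are added on opposite sides, so that adding and removing
  a box are both covered without truncated subtraction.\<close>

lemma psum_update:
  assumes "j < r"
  shows "psum r (A(j := (A j)(i := x))) k + (if i < k then A j i else 0)
       = psum r A k + (if i < k then x else 0)"
proof (induction k)
  case (Suc k)
  define B where "B = A(j := (A j)(i := x))"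
  have "(\<Sum>j'<r. B j' k) + (if i = k then A j i else 0)
      = (\<Sum>j'<r. A j' k) + (if i = k then x else 0)"
    using assms unfolding B_def by (subst (1 2) sum.remove[of "{..<r}" j]) auto
  then show ?case
    using Suc unfolding psum_Suc B_def[symmetric] by (auto simp: less_Suc_eq split: if_splits)
qed simp

text \<open>Used when the rows of \<open>B\<close> from \<open>k\<close> on are as short as
  interlacing permits: the surplus at \<open>k\<close> can then be computed from the surplus at
  \<open>m\<close>.\<close>

lemma psum_shift:
  assumes "\<And>j i. j < r \<Longrightarrow> k \<le> i \<Longrightarrow> i < m \<Longrightarrow> B j i = A j (Suc i)" and "k \<le> m"
  shows "psum r B m + psum r A (Suc k) = psum r B k + psum r A (Suc m)"
  using assms(2,1)
proof (induction m rule: dec_induct)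
  case (step n)
  have "(\<Sum>j<r. B j n) = (\<Sum>j<r. A j (Suc n))" using step by (intro sum.cong) auto
  then show ?case using step by (simp add: psum_Suc)
qed simp

text \<open>This is \<open>\<mu> m \<le> \<mu> k\<close>, in the form that combines linearly with
  \<open>psum_shift\<close>.\<close>

lemma sum_antimono_shift:
  fixes \<mu> :: "nat \<Rightarrow> nat"
  assumes "antimono \<mu>" "k \<le> m"
  shows "(\<Sum>i<Suc m. \<mu> i) + (\<Sum>i<k. \<mu> i) \<le> (\<Sum>i<m. \<mu> i) + (\<Sum>i<Suc k. \<mu> i)"
  using assms by (simp add: antimonoD)

section \<open>Removing and restoring the largest letter\<close>

lemma multi_pattern_extend:
  assumes G: "multi_pattern r m B \<mu> G" and AB: "interlacing r A B"
    and A: "dominating r (Suc m) A \<mu>"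
  shows "multi_pattern r (Suc m) A \<mu> (\<lambda>j i v. if v \<le> m then G j i v else A j i)"
proof -
  have "gt_pattern (Suc m) (A j) (\<lambda>i v. if v \<le> m then G j i v else A j i)" if j: "j < r" for j
  proof -
    have g: "gt_pattern m (B j) (G j)" using G j unfolding multi_pattern_def by simp
    have top: "G j i m = B j i" for i using g unfolding gt_pattern_def by simp
    have ab: "A j (Suc i) \<le> B j i" "B j i \<le> A j i" "A j (Suc i) \<le> A j i" for i
      using AB j unfolding interlacing_def by (blast intro: order_trans)+
    show ?thesis
      unfolding gt_pattern_def
    proof (intro conjI allI impI)
      fix i v
      show "(if 0 \<le> m then G j i 0 else A j i) = 0" using g unfolding gt_pattern_def by simp
      \<comment> \<open>The only new inequalities are those between level \<open>m\<close>, which is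
        the shape \<open>B\<close>, and level \<open>m + 1\<close>, which is \<open>A\<close>; they
        are the two halves of interlacing.\<close>
      have "Suc v \<le> m \<or> v = m \<or> m < v" by linarith
      then show "(if v \<le> m then G j i v else A j i) \<le> (if Suc v \<le> m then G j i (Suc v) else A j i)"
        using g ab top unfolding gt_pattern_def by auto
      have "Suc v \<le> m \<or> v = m \<or> m < v" by linarith
      then show "(if Suc v \<le> m then G j (Suc i) (Suc v) else A j (Suc i)) \<le> (if v \<le> m then G j i v else A j i)"
        using g ab top unfolding gt_pattern_def by auto
    qed auto
  qed
  moreover have "psum r (\<lambda>j i. if v \<le> m then G j i v else A j i) v = (\<Sum>i<v. \<mu> i)" if "v \<le> Suc m" for v
    using G A that unfolding multi_pattern_def dominating_def by (cases "v \<le> m") (auto simp: le_Suc_eq)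
  ultimately show ?thesis unfolding multi_pattern_def by blast
qed

text \<open>Extending two patterns of \<open>B\<close> by the same top level \<open>A\<close> keeps
  their lower levels, so a difference between them would survive.\<close>

lemma unique_pattern_restrict:
  assumes "unique_pattern r (Suc m) A \<mu>" and "dominating r (Suc m) A \<mu>" and "interlacing r A B"
  shows "unique_pattern r m B \<mu>"
  unfolding unique_pattern_def
proof (intro allI impI)
  fix G H j
  assume G: "multi_pattern r m B \<mu> G" and H: "multi_pattern r m B \<mu> H" and j: "j < r"
  have "(\<lambda>j i v. if v \<le> m then G j i v else A j i) j = (\<lambda>j i v. if v \<le> m then H j i v else A j i) j"
    using assms(1) multi_pattern_extend[OF G assms(3,2)] multi_pattern_extend[OF H assms(3,2)] j
    unfolding unique_pattern_def by blast
  then have eq: "G j i v = H j i v" if "v \<le> m" for i v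
    using that by (metis (full_types))
  have "G j i v = H j i v" for i v
  proof (cases "v \<le> m")
    case False
    then show ?thesis using G H j unfolding multi_pattern_def gt_pattern_def by simp
  qed (rule eq)
  then show "G j = H j" by blast
qed

lemma dominating_interlacing:
  assumes "interlacing r A B" "dominating r (Suc m) A \<mu>"
    and "\<And>j. j < r \<Longrightarrow> B j m = 0"
    and "\<And>k. k \<le> m \<Longrightarrow> (\<Sum>i<k. \<mu> i) \<le> psum r B k" and "psum r B m = (\<Sum>i<m. \<mu> i)"
  shows "dominating r m B \<mu>"
proof -
  have "antimono (B j) \<and> (\<forall>i\<ge>m. B j i = 0)" if j: "j < r" for j
  proof
    have "B j (Suc i) \<le> B j i" for i
      using assms(1) j unfolding interlacing_def by (blast intro: order_trans)
    then show an: "antimono (B j)" by (simp add: antimono_iff_le_Suc)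
    then show "\<forall>i\<ge>m. B j i = 0" using assms(3)[OF j] by (metis antimonoD le_zero_eq)
  qed
  then show ?thesis using assms unfolding dominating_def by blast
qed

text \<open>Among the shapes that may be left after removing the last letter, one with too many boxes
  can lose a box from the lowest possible row: the dominance inequalities survive because the
  rows below it have already been shortened as far as possible.\<close>

lemma interlacing_shrink:
  assumes A: "dominating r (Suc m) A \<mu>" and mu: "antimono \<mu>"
  shows "\<lbrakk>interlacing r A B; \<forall>j<r. B j m = 0; \<forall>k\<le>m. (\<Sum>i<k. \<mu> i) \<le> psum r B k\<rbrakk>
    \<Longrightarrow> \<exists>C. interlacing r A C \<and> dominating r m C \<mu>"
proof (induction "psum r B m" arbitrary: B rule: less_induct)
  case less
  show ?case
  proof (cases "psum r B m = (\<Sum>i<m. \<mu> i)")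
    case True
    then show ?thesis using dominating_interlacing[OF less.prems(1) A] less.prems by blast
  next
    case False
    then have big: "psum r B m > (\<Sum>i<m. \<mu> i)" using less.prems(3) by (simp add: le_neq_implies_less)
    define free where "free i \<longleftrightarrow> i < m \<and> (\<exists>j<r. A j (Suc i) < B j i)" for i
    have slack: "psum r B k > (\<Sum>i<k. \<mu> i)" if k: "k \<le> m" and no: "\<And>i. k \<le> i \<Longrightarrow> \<not> free i" for k
    proof -
      have "psum r B m + psum r A (Suc k) = psum r B k + psum r A (Suc m)"
      proof (rule psum_shift[OF _ k])
        fix j i assume "j < r" "k \<le> i" "i < m"
        then show "B j i = A j (Suc i)"
          using no[of i] less.prems(1) unfolding free_def interlacing_def
          by (metis le_neq_implies_less)
      qed
      moreover have "psum r A (Suc m) = (\<Sum>i<Suc m. \<mu> i)" "(\<Sum>i<Suc k. \<mu> i) \<le> psum r A (Suc k)"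
        using A k unfolding dominating_def by auto
      ultimately show ?thesis using sum_antimono_shift[OF mu k] big by linarith
    qed
    \<comment> \<open>Without a free row, \<open>slack\<close> at 0 would compare two empty sums
      strictly.\<close>
    have ex: "\<exists>i. free i" using slack[of 0] by auto
    have bnd: "\<And>i. free i \<Longrightarrow> i \<le> m" unfolding free_def by simp
    define i where "i = (GREATEST i. free i)"
    have fi: "free i" unfolding i_def using ex bnd by (metis GreatestI_nat)
    have mx: "\<not> free i'" if "Suc i \<le> i'" for i'
      using that bnd unfolding i_def by (metis Greatest_le_nat not_less_eq_eq)
    obtain j where j: "j < r" "A j (Suc i) < B j i" and i: "i < m" using fi unfolding free_def by blast
    define C where "C = B(j := (B j)(i := B j i - 1))"
    have C: "psum r C k + (if i < k then 1 else 0) = psum r B k" for k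
      using psum_update[OF j(1), of B i "B j i - 1" k] j(2) unfolding C_def by (auto split: if_splits)
    show ?thesis
    proof (rule less.hyps[of C])
      show "psum r C m < psum r B m" using C[of m] i by simp
      show "interlacing r A C"
        using less.prems(1) j unfolding interlacing_def C_def by (auto simp: le_diff_conv intro: le_SucI)
      show "\<forall>j<r. C j m = 0" using less.prems(2) i unfolding C_def by simp
      show "\<forall>k\<le>m. (\<Sum>i<k. \<mu> i) \<le> psum r C k"
      proof (intro allI impI)
        fix k assume k: "k \<le> m"
        show "(\<Sum>i<k. \<mu> i) \<le> psum r C k"
        proof (cases "i < k")
          case True
          then have "psum r B k > (\<Sum>i<k. \<mu> i)" using slack[OF k] mx by simp
          then show ?thesis using C[of k] True by simp
        next
          case False
          then show ?thesis using C[of k] less.prems(3) k by simp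
        qed
      qed
    qed
  qed
qed

lemma dominating_interlacing_exists:
  assumes A: "dominating r (Suc m) A \<mu>" and mu: "antimono \<mu>"
  obtains B where "interlacing r A B" "dominating r m B \<mu>"
proof -
  \<comment> \<open>The largest shape available: only row \<open>m\<close>, which cannot remain with
    \<open>m\<close> letters, is deleted, and dominance at \<open>k \<le> m\<close> is inherited
    from \<open>A\<close>.\<close>
  define B where "B = (\<lambda>j i. if i < m then A j i else 0)"
  have "interlacing r A B"
    using A unfolding interlacing_def B_def dominating_def by (auto simp: antimono_iff_le_Suc)
  moreover have "\<forall>j<r. B j m = 0" unfolding B_def by simp
  moreover have "\<forall>k\<le>m. (\<Sum>i<k. \<mu> i) \<le> psum r B k"
  proof (intro allI impI)
    fix k assume k: "k \<le> m"
    have "psum r B k = psum r A k" using k unfolding B_def by (intro psum_cong) simp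
    then show "(\<Sum>i<k. \<mu> i) \<le> psum r B k" using A k unfolding dominating_def by simp
  qed
  ultimately show ?thesis using interlacing_shrink[OF A mu] that by blast
qed

text \<open>The letters are peeled off from the largest down. This is the multitableau version of
  the positivity of Kostka numbers under dominance.\<close>

lemma multi_pattern_exists:
  assumes mu: "antimono \<mu>"
  shows "dominating r m A \<mu> \<Longrightarrow> \<exists>G. multi_pattern r m A \<mu> G"
proof (induction m arbitrary: A)
  case 0
  then have "multi_pattern r 0 A \<mu> (\<lambda>j i v. 0)"
    unfolding multi_pattern_def gt_pattern_def dominating_def by simp
  then show ?case by blast
next
  case (Suc m)
  obtain B where "interlacing r A B" "dominating r m B \<mu>"
    by (rule dominating_interlacing_exists[OF Suc.prems mu])
  then show ?case using Suc multi_pattern_extend by blast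
qed

text \<open>Every admissible shape carries a pattern and reappears as level \<open>m\<close> of its
  extension to \<open>A\<close>, so two admissible shapes would give two patterns.\<close>

lemma unique_interlacing:
  assumes u: "unique_pattern r (Suc m) A \<mu>" and A: "dominating r (Suc m) A \<mu>" and mu: "antimono \<mu>"
    and B: "interlacing r A B" "dominating r m B \<mu>" and C: "interlacing r A C" "dominating r m C \<mu>"
    and j: "j < r"
  shows "B j = C j"
proof -
  obtain G H where G: "multi_pattern r m B \<mu> G" and H: "multi_pattern r m C \<mu> H"
    using multi_pattern_exists[OF mu] B(2) C(2) by blast
  have "(\<lambda>j i v. if v \<le> m then G j i v else A j i) j = (\<lambda>j i v. if v \<le> m then H j i v else A j i) j"
    using u multi_pattern_extend[OF G B(1) A] multi_pattern_extend[OF H C(1) A] j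
    unfolding unique_pattern_def by blast
  then have "G j i m = H j i m" for i by (metis (full_types) order_refl)
  moreover have "G j i m = B j i" "H j i m = C j i" for i
    using G H j unfolding multi_pattern_def gt_pattern_def by auto
  ultimately show ?thesis by auto
qed

subsection \<open>Exchanging boxes in the strict case\<close>

text \<open>Moving a box from row \<open>i'\<close> of component \<open>j'\<close> to row
  \<open>i\<close> of component \<open>j\<close> would give a second admissible shape. Only the
  prefix sums at \<open>k\<close> with \<open>i' < k \<le> i\<close> drop, each by one, and
  \<open>slack\<close> absorbs this; if \<open>i \<le> i'\<close>, none drops.\<close>

lemma unique_interlacing_no_exchange:
  assumes u: "unique_pattern r (Suc m) A \<mu>" and A: "dominating r (Suc m) A \<mu>" and mu: "antimono \<mu>"
    and B: "interlacing r A B" "dominating r m B \<mu>"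
    and ji: "j < r" "i < m" "B j i < A j i"
    and ji': "j' < r" "i' < m" "A j' (Suc i') < B j' i'"
    and ne: "(j, i) \<noteq> (j', i')"
    and slack: "\<And>k. i' < k \<Longrightarrow> k \<le> i \<Longrightarrow> (\<Sum>i<k. \<mu> i) < psum r B k"
  shows False
proof -
  define C where "C = B(j := (B j)(i := B j i + 1))"
  define D where "D = C(j' := (C j')(i' := B j' i' - 1))"
  have C: "psum r C k = psum r B k + (if i < k then 1 else 0)" for k
    using psum_update[OF ji(1), of B i "B j i + 1" k] unfolding C_def by (auto split: if_splits)
  have Cj': "C j' i' = B j' i'" using ne unfolding C_def by auto
  have D: "psum r D k + (if i' < k then 1 else 0) = psum r B k + (if i < k then 1 else 0)" for k
    using psum_update[OF ji'(1), of C i' "B j' i' - 1" k] ji'(3) Cj' C[of k]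
    unfolding D_def by (auto split: if_splits)
  have Dval: "D x y = (if (x, y) = (j, i) then B j i + 1 else if (x, y) = (j', i') then B j' i' - 1 else B x y)"
    for x y using ne unfolding D_def C_def by auto
  have int: "interlacing r A D"
    unfolding interlacing_def
  proof (intro allI impI)
    fix x y assume "x < r"
    then have "A x (Suc y) \<le> B x y" "B x y \<le> A x y" using B(1) unfolding interlacing_def by auto
    then show "A x (Suc y) \<le> D x y \<and> D x y \<le> A x y" using ji(3) ji'(3) unfolding Dval by auto
  qed
  have "dominating r m D \<mu>"
  proof (rule dominating_interlacing[OF int A])
    show "D x m = 0" if "x < r" for x
      using B(2) ji(2) ji'(2) that unfolding Dval dominating_def by auto
    show "psum r D m = (\<Sum>i<m. \<mu> i)"
      using D[of m] ji(2) ji'(2) B(2) unfolding dominating_def by simp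
    show "(\<Sum>i<k. \<mu> i) \<le> psum r D k" if "k \<le> m" for k
    proof -
      have "(\<Sum>i<k. \<mu> i) \<le> psum r B k" using B(2) that unfolding dominating_def by simp
      then show ?thesis using D[of k] slack[of k] by (auto split: if_splits)
    qed
  qed
  then have "B j = D j" using unique_interlacing[OF u A mu B int _ ji(1)] by blast
  then have "B j i = D j i" by simp
  then show False unfolding Dval by simp
qed

text \<open>The situation inside a block that cannot be cut any further.\<close>

definition strictly_dominating :: "nat \<Rightarrow> nat \<Rightarrow> (nat \<Rightarrow> nat \<Rightarrow> nat) \<Rightarrow> (nat \<Rightarrow> nat) \<Rightarrow> bool" where
  "strictly_dominating r m A \<mu> \<longleftrightarrow>
     dominating r m A \<mu> \<and> (\<forall>k. 0 < k \<and> k < m \<longrightarrow> (\<Sum>i<k. \<mu> i) < psum r A k)"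

text \<open>The forbidden exchanges are applied first with \<open>(j0, a)\<close> receiving a box,
  which forces all other rows of \<open>B\<close> to their lower bounds, and then with
  \<open>(j0, a)\<close> giving one, which makes all other neighbouring rows of \<open>A\<close>
  equal. Strictness of \<open>B\<close> is recorded so that the argument can be repeated for
  it.\<close>

lemma strictly_dominating_jump:
  assumes u: "unique_pattern r (Suc m) A \<mu>" and sA: "strictly_dominating r (Suc m) A \<mu>"
    and mu: "antimono \<mu>" and m: "0 < m"
  obtains j0 a B where "j0 < r" "a < m"
    "\<And>j i. \<lbrakk>j < r; i < m; (j, i) \<noteq> (j0, a)\<rbrakk> \<Longrightarrow> A j i = A j (Suc i) \<and> B j i = A j (Suc i)"
    "A j0 (Suc a) < B j0 a" "B j0 a < A j0 a"
    "interlacing r A B" "strictly_dominating r m B \<mu>"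
proof -
  have A: "dominating r (Suc m) A \<mu>"
    and strict: "\<And>k. 0 < k \<Longrightarrow> k \<le> m \<Longrightarrow> (\<Sum>i<k. \<mu> i) < psum r A k"
    using sA unfolding strictly_dominating_def by auto
  have S: "psum r A (Suc m) = (\<Sum>i<Suc m. \<mu> i)" using A unfolding dominating_def by simp
  obtain B where B: "interlacing r A B" "dominating r m B \<mu>"
    by (rule dominating_interlacing_exists[OF A mu])
  have T: "psum r B m = (\<Sum>i<m. \<mu> i)" using B(2) unfolding dominating_def by simp
  have BA: "A j (Suc i) \<le> B j i" "B j i \<le> A j i" if "j < r" for j i
    using B(1) that unfolding interlacing_def by auto
  note no_exchange = unique_interlacing_no_exchange[OF u A mu B]
  define free where "free i \<longleftrightarrow> i < m \<and> (\<exists>j<r. B j i < A j i)" for i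
  have "\<exists>i. free i"
  proof (rule ccontr)
    assume "\<nexists>i. free i"
    then have "psum r B m = psum r A m"
      using BA(2) unfolding free_def by (intro psum_cong) (meson le_neq_implies_less)
    then show False using T strict[OF m] by simp
  qed
  \<comment> \<open>The topmost row with room for a box: above it \<open>B\<close> agrees with
    \<open>A\<close> and inherits its strict inequalities.\<close>
  define a where "a = (LEAST i. free i)"
  have "free a" unfolding a_def using \<open>\<exists>i. free i\<close> by (metis LeastI)
  then obtain j0 where j0: "j0 < r" "a < m" "B j0 a < A j0 a" unfolding free_def by blast
  have below: "B j i = A j i" if "j < r" "i < a" for j i
  proof -
    have "\<not> free i" using not_less_Least[of i free] that(2) unfolding a_def by simp
    then have "\<not> B j i < A j i" using that j0(2) unfolding free_def by auto
    then show ?thesis using BA(2)[OF that(1), of i] by simp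
  qed
  have slack_low: "(\<Sum>i<k. \<mu> i) < psum r B k" if "0 < k" "k \<le> a" for k
  proof -
    have "psum r B k = psum r A k" using below that by (intro psum_cong) simp
    then show ?thesis using strict[of k] that j0(2) by simp
  qed
  \<comment> \<open>A box removable elsewhere could move to \<open>(j0, a)\<close>; prefix sums
    would drop only at positions up to \<open>a\<close>, where \<open>slack_low\<close>
    applies.\<close>
  have full: "B j i = A j (Suc i)" if "j < r" "i < m" "(j, i) \<noteq> (j0, a)" for j i
  proof (rule ccontr)
    assume "B j i \<noteq> A j (Suc i)"
    then have "A j (Suc i) < B j i" using BA(1)[OF that(1), of i] by simp
    then show False
      using no_exchange[OF j0 that(1,2)] that(3) slack_low by (metis gr_implies_not0 neq0_conv)
  qed
  \<comment> \<open>The shift argument again. At \<open>m\<close> there is no surplus now, and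
    strictness of \<open>A\<close> at \<open>Suc k\<close> supplies the strict inequality.\<close>
  have slack_high: "(\<Sum>i<k. \<mu> i) < psum r B k" if "k < m" "\<And>j i. \<lbrakk>j < r; k \<le> i; i < m\<rbrakk> \<Longrightarrow> B j i = A j (Suc i)" for k
  proof -
    have "psum r B m + psum r A (Suc k) = psum r B k + psum r A (Suc m)"
      using that by (intro psum_shift) auto
    moreover have "(\<Sum>i<Suc k. \<mu> i) < psum r A (Suc k)" using strict[of "Suc k"] that(1) by simp
    ultimately show ?thesis using S T sum_antimono_shift[OF mu, of k m] that(1) by linarith
  qed
  \<comment> \<open>Otherwise all rows of \<open>B\<close> would be at their lower bounds, and
    \<open>slack_high\<close> at 0 would compare empty sums strictly.\<close>
  have jump: "A j0 (Suc a) < B j0 a"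
  proof (rule ccontr)
    assume "\<not> A j0 (Suc a) < B j0 a"
    then have "B j0 a = A j0 (Suc a)" using BA(1)[OF j0(1), of a] by simp
    then have "B j i = A j (Suc i)" if "j < r" "i < m" for j i using full that by (cases "(j, i) = (j0, a)") auto
    then show False using slack_high[of 0] m by auto
  qed
  have slack: "(\<Sum>i<k. \<mu> i) < psum r B k" if "0 < k" "k < m" for k
    using slack_low slack_high[of k] full that by (cases "k \<le> a") auto
  \<comment> \<open>Since \<open>B\<close> is at its lower bound there, an unequal pair of
    \<open>A\<close> would leave room for a box, which \<open>(j0, a)\<close> could give.\<close>
  have flat: "A j i = A j (Suc i)" if "j < r" "i < m" "(j, i) \<noteq> (j0, a)" for j i
  proof (rule ccontr)
    assume "A j i \<noteq> A j (Suc i)"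
    then have "B j i < A j i" using full[OF that] BA[OF that(1), of i] by simp
    then show False
      using no_exchange[OF that(1,2) _ j0(1,2) jump that(3)] slack that(2) by simp
  qed
  have "strictly_dominating r m B \<mu>" using B(2) slack unfolding strictly_dominating_def by simp
  then show ?thesis using that[OF j0(1,2) _ jump j0(3) B(1)] flat full by blast
qed

text \<open>\<open>B j0 a\<close> lies strictly between \<open>A j0 (Suc a)\<close> and
  \<open>A j0 a\<close>, while for an inner row \<open>a\<close> the neighbouring rows of
  \<open>B\<close> have these two lengths. So \<open>B\<close> would drop at \<open>a - 1\<close>
  and at \<open>a\<close>, whereas \<open>strictly_dominating_jump\<close> for \<open>B\<close>
  permits one drop.\<close>

lemma strictly_dominating_single_jump:
  assumes u: "unique_pattern r (Suc m) A \<mu>" and sA: "strictly_dominating r (Suc m) A \<mu>"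
    and mu: "antimono \<mu>" and m: "0 < m"
  obtains j0 a where "j0 < r" "a = 0 \<or> Suc a = m" "A j0 (Suc a) < A j0 a"
    "\<And>j i. \<lbrakk>j < r; i < m; (j, i) \<noteq> (j0, a)\<rbrakk> \<Longrightarrow> A j i = A j (Suc i)"
proof -
  obtain j0 a B where ja: "j0 < r" "a < m"
    and flat: "\<And>j i. \<lbrakk>j < r; i < m; (j, i) \<noteq> (j0, a)\<rbrakk> \<Longrightarrow> A j i = A j (Suc i) \<and> B j i = A j (Suc i)"
    and jump: "A j0 (Suc a) < B j0 a" "B j0 a < A j0 a"
    and B: "interlacing r A B" "strictly_dominating r m B \<mu>"
    using strictly_dominating_jump[OF assms] by blast
  have "a = 0 \<or> Suc a = m"
  proof (rule ccontr)
    assume "\<not> (a = 0 \<or> Suc a = m)"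
    \<comment> \<open>\<open>B\<close> has \<open>Suc m'\<close> rows; \<open>a < m'\<close> places
      both drops, at \<open>b\<close> and at \<open>a\<close>, among its pairs of consecutive
      rows.\<close>
    then obtain b m' where b: "a = Suc b" and m': "m = Suc m'" "a < m'" "0 < m'"
      using ja(2) by (cases a; cases m) auto
    have "unique_pattern r m B \<mu>"
      using unique_pattern_restrict[OF u _ B(1)] sA unfolding strictly_dominating_def by blast
    then obtain j1 c where flat': "\<And>j i. \<lbrakk>j < r; i < m'; (j, i) \<noteq> (j1, c)\<rbrakk> \<Longrightarrow> B j i = B j (Suc i)"
      using strictly_dominating_jump[OF _ _ mu m'(3), of r B] B(2) unfolding m'(1) by metis
    have "B j0 b = A j0 a" using flat[OF ja(1), of b] b ja(2) by simp
    moreover have "B j0 (Suc a) = A j0 (Suc a)"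
      using flat[OF ja(1), of "Suc a"] m' by simp
    ultimately have "B j0 b \<noteq> B j0 (Suc b)" "B j0 a \<noteq> B j0 (Suc a)" using jump b by auto
    moreover have "b < m'" using m'(2) b by simp
    ultimately have "(j0, b) = (j1, c)" "(j0, a) = (j1, c)"
      using flat'[OF ja(1), of b] flat'[OF ja(1), of a] m'(2) by blast+
    then show False using b by simp
  qed
  then show ?thesis using that[OF ja(1), of a] jump flat by auto
qed

subsection \<open>Blocks\<close>

text \<open>At level \<open>p\<close> the first \<open>p\<close> rows already contain as many boxes
  as the whole shape has there, so each of these rows is complete from level \<open>p\<close>
  on.\<close>

lemma multi_pattern_saturated:
  assumes G: "multi_pattern r m A \<mu> G" and eq: "psum r A p = (\<Sum>i<p. \<mu> i)"
    and j: "j < r" and i: "i < p" and v: "p \<le> v" and p: "p \<le> m"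
  shows "G j i v = A j i"
proof -
  have g: "gt_pattern m (A j) (G j)" if "j < r" for j
    using G that unfolding multi_pattern_def by simp
  have "psum r (\<lambda>j i. G j i p) p = psum r A p" using G eq p unfolding multi_pattern_def by simp
  then have "G j i p = A j i"
    using gt_pattern_le[OF g] j i by (intro psum_eq_imp_eq[of r p "\<lambda>j i. G j i p" A]) auto
  then show ?thesis
    using gt_pattern_le[OF g[OF j], of i v] gt_pattern_mono[OF g[OF j] v, of i] by simp
qed

lemma block_less: "p + i < q \<Longrightarrow> block p q \<alpha> i = \<alpha> (p + i)"
  by (simp add: block_def)

lemma psum_block:
  assumes "p + k \<le> q"
  shows "psum r A p + psum r (\<lambda>j. block p q (A j)) k = psum r A (p + k)"
  using assms by (induction k) (simp_all add: psum_Suc block_less)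

lemma sum_block:
  assumes "p + k \<le> q"
  shows "(\<Sum>i<p. \<mu> i) + (\<Sum>i<k. block p q \<mu> i) = (\<Sum>i<p + k. \<mu> i)"
  using assms by (induction k) (simp_all add: block_less)

text \<open>The rows before \<open>p\<close> are complete at level \<open>p\<close> and those of the
  block at level \<open>q\<close>, so the block can be refilled with its own letters. Truncation in
  \<open>v - p\<close> is harmless, since level 0 of \<open>H\<close> is empty.\<close>

lemma multi_pattern_replace_block:
  assumes G: "multi_pattern r m A \<mu> G" and A: "\<And>j. j < r \<Longrightarrow> antimono (A j)"
    and pq: "p < q" "q \<le> m"
    and eqp: "psum r A p = (\<Sum>i<p. \<mu> i)" and eqq: "psum r A q = (\<Sum>i<q. \<mu> i)"
    and H: "multi_pattern r (q - p) (\<lambda>j. block p q (A j)) (block p q \<mu>) H"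
  shows "multi_pattern r m A \<mu>
           (\<lambda>j i v. if p \<le> i \<and> i < q then H j (i - p) (v - p) else G j i v)"
    (is "multi_pattern r m A \<mu> ?G'")
proof -
  have g: "gt_pattern m (A j) (G j)" if "j < r" for j
    using G that unfolding multi_pattern_def by simp
  have h: "gt_pattern (q - p) (block p q (A j)) (H j)" if "j < r" for j
    using H that unfolding multi_pattern_def by simp
  have Gp: "G j i v = A j i" if "j < r" "i < p" "p \<le> v" for j i v
    using multi_pattern_saturated[OF G eqp that] pq by simp
  have Gq: "G j i v = A j i" if "j < r" "i < q" "q \<le> v" for j i v
    using multi_pattern_saturated[OF G eqq that] pq by simp
  have Hq: "H j (i - p) (v - p) = A j i" if "j < r" "p \<le> i" "i < q" "q \<le> v" for j i v
    using h[OF that(1)] that unfolding gt_pattern_def by (simp add: block_less)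
  have "gt_pattern m (A j) (?G' j)" if j: "j < r" for j
    unfolding gt_pattern_def
  proof (intro conjI allI impI)
    fix i v
    show "?G' j i 0 = 0" using g[OF j] h[OF j] unfolding gt_pattern_def by simp
    show "?G' j i v \<le> ?G' j i (Suc v)"
      using gt_pattern_mono[OF g[OF j], of v "Suc v"] gt_pattern_mono[OF h[OF j], of "v - p" "Suc v - p"]
      by simp
    show "?G' j (Suc i) (Suc v) \<le> ?G' j i v"
    proof -
      \<comment> \<open>The two patterns meet only at the seams \<open>Suc i = p\<close> and
        \<open>Suc i = q\<close>.\<close>
      consider "Suc i < p \<or> q \<le> i" | "Suc i = p" | "p \<le> i" "Suc i < q" | "p \<le> i" "Suc i = q" by linarith
      then show ?thesis
      proof cases
        case 1
        then show ?thesis using g[OF j] unfolding gt_pattern_def by auto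
      next
        case 2
        show ?thesis
        proof (cases "p \<le> v")
          case True
          have "H j 0 (Suc v - p) \<le> A j p" using gt_pattern_le[OF h[OF j], of 0] pq by (simp add: block_less)
          also have "\<dots> \<le> A j i" using A[OF j] 2 by (simp add: antimonoD)
          finally show ?thesis using 2 Gp[OF j, of i v] True pq by auto
        next
          case False
          then have "Suc v - p = 0" by simp
          then show ?thesis using 2 pq h[OF j] unfolding gt_pattern_def by auto
        qed
      next
        case 3
        show ?thesis
        proof (cases "p \<le> v")
          case True
          then show ?thesis using 3 h[OF j] unfolding gt_pattern_def by (simp add: Suc_diff_le)
        next
          case False
          then have "Suc v - p = 0" by simp
          then show ?thesis using 3 h[OF j] unfolding gt_pattern_def by simp
        qed
      next
        case 4
        show ?thesis
        proof (cases "q \<le> v")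
          case True
          have "G j (Suc i) (Suc v) \<le> A j (Suc i)" by (rule gt_pattern_le[OF g[OF j]])
          also have "\<dots> \<le> A j i" using A[OF j] by (simp add: antimonoD)
          finally show ?thesis using 4 True Hq[OF j, of i v] by simp
        next
          case False
          then show ?thesis using 4 gt_pattern_eq_0[OF g[OF j], of "Suc v" "Suc i"] by simp
        qed
      qed
    qed
    show "?G' j i v = A j i" if "m \<le> v"
      using that g[OF j] Hq[OF j, of i v] pq unfolding gt_pattern_def by simp
  qed
  moreover have "psum r (\<lambda>j i. ?G' j i v) v = (\<Sum>i<v. \<mu> i)" if v: "v \<le> m" for v
  proof -
    have eq: "psum r (\<lambda>j i. G j i v) v = (\<Sum>i<v. \<mu> i)" using G v unfolding multi_pattern_def by simp
    consider "v \<le> p" | "p < v" "v \<le> q" | "q < v" by linarith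
    then show ?thesis
    proof cases
      case 1
      then have "psum r (\<lambda>j i. ?G' j i v) v = psum r (\<lambda>j i. G j i v) v" by (intro psum_cong) simp
      then show ?thesis using eq by simp
    next
      case 3
      then have "psum r (\<lambda>j i. ?G' j i v) v = psum r (\<lambda>j i. G j i v) v"
        by (intro psum_cong) (simp add: Hq Gq)
      then show ?thesis using eq by simp
    next
      case 2
      define k where "k = v - p"
      have k: "v = p + k" "k \<le> q - p" using 2 unfolding k_def by auto
      \<comment> \<open>At a level inside the block, the complete rows before it contribute
        \<open>psum r A p\<close> and its own rows contribute level \<open>k\<close> of
        \<open>H\<close>.\<close>
      have shift: "psum r (\<lambda>j i. ?G' j i v) (p + k') = psum r A p + psum r (\<lambda>j i. H j i k) k'" if "k' \<le> k" for k'
        using that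
      proof (induction k')
        case 0
        have "psum r (\<lambda>j i. ?G' j i v) p = psum r A p" using 2 by (intro psum_cong) (simp add: Gp)
        then show ?case by simp
      next
        case (Suc k')
        have "p + k' < q" "v - p = k" using Suc.prems k by auto
        then show ?case using Suc by (simp add: psum_Suc)
      qed
      have "psum r (\<lambda>j i. H j i k) k = (\<Sum>i<k. block p q \<mu> i)"
        using H k unfolding multi_pattern_def by simp
      then show ?thesis using shift[of k] k sum_block[of p k q \<mu>] eqp pq by simp
    qed
  qed
  ultimately show ?thesis unfolding multi_pattern_def by blast
qed

text \<open>Two patterns of the block are inserted into one ambient pattern \<open>G\<close>, from
  which they can be read off again.\<close>

lemma unique_pattern_block:
  assumes u: "unique_pattern r m A \<mu>" and G: "multi_pattern r m A \<mu> G" and A: "\<And>j. j < r \<Longrightarrow> antimono (A j)"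
    and pq: "p < q" "q \<le> m"
    and eqp: "psum r A p = (\<Sum>i<p. \<mu> i)" and eqq: "psum r A q = (\<Sum>i<q. \<mu> i)"
  shows "unique_pattern r (q - p) (\<lambda>j. block p q (A j)) (block p q \<mu>)"
  unfolding unique_pattern_def
proof (intro allI impI)
  fix H K j
  assume H: "multi_pattern r (q - p) (\<lambda>j. block p q (A j)) (block p q \<mu>) H"
    and K: "multi_pattern r (q - p) (\<lambda>j. block p q (A j)) (block p q \<mu>) K" and j: "j < r"
  let ?R = "\<lambda>H j i v. if p \<le> i \<and> i < q then H j (i - p) (v - p) else G j i v"
  have eq: "?R H j = ?R K j"
    using u multi_pattern_replace_block[OF G A pq eqp eqq H] multi_pattern_replace_block[OF G A pq eqp eqq K] j
    unfolding unique_pattern_def by blast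
  have "H j i v = K j i v" for i v
  proof (cases "p + i < q")
    case True
    then show ?thesis using fun_cong[OF fun_cong[OF eq, of "p + i"], of "p + v"] by simp
  next
    case False
    have "H j i v \<le> block p q (A j) i" "K j i v \<le> block p q (A j) i"
      using H K j gt_pattern_le unfolding multi_pattern_def by blast+
    then show ?thesis using False by (simp add: block_def)
  qed
  then show "H j = K j" by blast
qed

text \<open>The letters up to \<open>k\<close> all lie in the first \<open>k\<close> rows, so there
  is room for at most \<open>psum r A k\<close> of them.\<close>

lemma multi_pattern_imp_dominating:
  assumes G: "multi_pattern r m A \<mu> G" and A: "\<And>j. j < r \<Longrightarrow> antimono (A j)"
  shows "dominating r m A \<mu>"
proof -
  have g: "gt_pattern m (A j) (G j)" if "j < r" for j
    using G that unfolding multi_pattern_def by simp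
  have "A j i = 0" if "j < r" "m \<le> i" for j i
    using gt_pattern_eq_0[OF g[OF that(1)] that(2)] g[OF that(1)] unfolding gt_pattern_def by simp
  moreover have "(\<Sum>i<k. \<mu> i) \<le> psum r A k" if k: "k \<le> m" for k
  proof -
    have "psum r (\<lambda>j i. G j i k) k \<le> psum r A k" using gt_pattern_le[OF g] by (intro psum_mono) simp
    then show ?thesis using G k unfolding multi_pattern_def by simp
  qed
  moreover have "psum r A m = (\<Sum>i<m. \<mu> i)"
  proof -
    have "psum r (\<lambda>j i. G j i m) m = psum r A m"
      using g unfolding gt_pattern_def by (intro psum_cong) simp
    then show ?thesis using G unfolding multi_pattern_def by simp
  qed
  ultimately show ?thesis using A unfolding dominating_def by simp
qed

text \<open>At a level \<open>v\<close> inside the block, row \<open>i\<close> lies between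
  \<open>A j (i + (q - v))\<close>, reached along the diagonal at the saturated level
  \<open>q\<close>, and \<open>A j i\<close>. The hypothesis \<open>rigid\<close> makes these bounds
  coincide in all places but one.\<close>

lemma multi_pattern_eq_block:
  assumes G: "multi_pattern r m A \<mu> G" and H: "multi_pattern r m A \<mu> H"
    and pq: "p < q" "q \<le> m"
    and eqp: "psum r A p = (\<Sum>i<p. \<mu> i)" and eqq: "psum r A q = (\<Sum>i<q. \<mu> i)"
    and rigid: "\<And>v. \<lbrakk>p < v; v < q\<rbrakk> \<Longrightarrow> \<exists>j0 i0. \<forall>j<r. \<forall>i. p \<le> i \<and> i < v \<and> (j, i) \<noteq> (j0, i0)
                  \<longrightarrow> A j (i + (q - v)) = A j i"
    and j: "j < r" and i: "p \<le> i" "i < q"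
  shows "G j i v = H j i v"
proof -
  have bounds: "F j i v \<le> A j i" "i < v \<Longrightarrow> v \<le> q \<Longrightarrow> A j (i + (q - v)) \<le> F j i v" "v \<le> i \<Longrightarrow> F j i v = 0"
    "i < p \<Longrightarrow> p \<le> v \<Longrightarrow> F j i v = A j i" "i < q \<Longrightarrow> q \<le> v \<Longrightarrow> F j i v = A j i"
    if F: "multi_pattern r m A \<mu> F" and j: "j < r" for F j i v
  proof -
    have g: "gt_pattern m (A j) (F j)" using F j unfolding multi_pattern_def by simp
    show "F j i v \<le> A j i" by (rule gt_pattern_le[OF g])
    show "v \<le> i \<Longrightarrow> F j i v = 0" by (rule gt_pattern_eq_0[OF g])
    show "i < p \<Longrightarrow> p \<le> v \<Longrightarrow> F j i v = A j i"
      using multi_pattern_saturated[OF F eqp j] pq by simp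
    show sat: "i < q \<Longrightarrow> q \<le> v \<Longrightarrow> F j i v = A j i" for i v
      using multi_pattern_saturated[OF F eqq j] pq by simp
    assume "i < v" "v \<le> q"
    then show "A j (i + (q - v)) \<le> F j i v"
      using gt_pattern_diagonal[OF g, of i "q - v" v] sat[of "i + (q - v)" q] by simp
  qed
  consider "v \<le> i" | "q \<le> v" | "i < v" "v < q" by linarith
  then show ?thesis
  proof cases
    case 1
    then show ?thesis using bounds(3)[OF G j] bounds(3)[OF H j] by simp
  next
    case 2
    then show ?thesis using bounds(5)[OF G j] bounds(5)[OF H j] i by simp
  next
    case 3
    then obtain j0 i0 where free: "\<And>j i. \<lbrakk>j < r; p \<le> i; i < v; (j, i) \<noteq> (j0, i0)\<rbrakk> \<Longrightarrow> A j (i + (q - v)) = A j i"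
      using rigid[of v] i by auto
    have det: "G j i v = H j i v" if "j < r" "i < v" "(j, i) \<noteq> (j0, i0)" for j i
    proof (cases "i < p")
      case True
      then show ?thesis using bounds(4)[OF G that(1)] bounds(4)[OF H that(1)] 3 i by simp
    next
      case False
      then show ?thesis
        using bounds(1,2)[OF G that(1), of i v] bounds(1,2)[OF H that(1), of i v] free[OF that(1) _ that(2,3)] 3 that
        by simp
    qed
    show ?thesis
    proof (cases "(j, i) = (j0, i0)")
      case True
      \<comment> \<open>Both patterns have the same total at level \<open>v\<close>, prescribed by
        \<open>\<mu>\<close>; all other summands agree, hence so does the remaining one.\<close>
      have "psum r (\<lambda>j i. G j i v) v = psum r (\<lambda>j i. H j i v) v"
        using G H 3 pq unfolding multi_pattern_def by simp
      moreover have "psum r F v = F j i + (\<Sum>i'\<in>{..<v} - {i}. \<Sum>j'<r. F j' i') + (\<Sum>j'\<in>{..<r} - {j}. F j' i)"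
        for F :: "nat \<Rightarrow> nat \<Rightarrow> nat"
        unfolding psum_def using 3(1) j
        by (subst sum.remove[of _ i], simp, simp, subst sum.remove[of "{..<r}" j]) auto
      moreover have "(\<Sum>i'\<in>{..<v} - {i}. \<Sum>j'<r. G j' i' v) = (\<Sum>i'\<in>{..<v} - {i}. \<Sum>j'<r. H j' i' v)"
        using det True by (intro sum.cong) auto
      moreover have "(\<Sum>j'\<in>{..<r} - {j}. G j' i v) = (\<Sum>j'\<in>{..<r} - {j}. H j' i v)"
        using det True 3 by (intro sum.cong) auto
      ultimately show ?thesis by simp
    next
      case False
      then show ?thesis using det j 3 by blast
    qed
  qed
qed

subsection \<open>Tableaux as patterns\<close>

definition pattern_of :: "(nat \<Rightarrow> nat) \<Rightarrow> (nat \<Rightarrow> nat \<Rightarrow> nat) \<Rightarrow> nat \<Rightarrow> nat \<Rightarrow> nat" where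
  "pattern_of \<alpha> T i v = card {c. c < \<alpha> i \<and> T i c \<le> v}"

text \<open>The inverse of \<open>pattern_of\<close>: a cell carries the letter at whose level its
  row first reaches it. The default 0 is what \<open>semistandard\<close> demands off the
  diagram.\<close>

definition tableau_of :: "(nat \<Rightarrow> nat) \<Rightarrow> (nat \<Rightarrow> nat \<Rightarrow> nat) \<Rightarrow> nat \<Rightarrow> nat \<Rightarrow> nat" where
  "tableau_of \<alpha> g i c = (if c < \<alpha> i then LEAST v. c < g i v else 0)"

section \<open>The correspondence for one component\<close>

lemma semistandardD:
  assumes "semistandard \<alpha> T"
  shows "c < \<alpha> i \<Longrightarrow> 1 \<le> T i c" "\<not> c < \<alpha> i \<Longrightarrow> T i c = 0"
    "c \<le> d \<Longrightarrow> d < \<alpha> i \<Longrightarrow> T i c \<le> T i d"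
    "i < j \<Longrightarrow> c < \<alpha> i \<Longrightarrow> c < \<alpha> j \<Longrightarrow> T i c < T j c"
proof -
  show "c \<le> d \<Longrightarrow> d < \<alpha> i \<Longrightarrow> T i c \<le> T i d"
    using assms unfolding semistandard_def diagram_def by (cases "c = d") auto
qed (use assms in \<open>auto simp: semistandard_def diagram_def\<close>)

text \<open>Rows increase weakly, so the entries at most \<open>v\<close> form an initial segment,
  and counting them locates its end.\<close>

lemma less_pattern_of_iff:
  assumes T: "semistandard \<alpha> T" and c: "c < \<alpha> i"
  shows "c < pattern_of \<alpha> T i v \<longleftrightarrow> T i c \<le> v"
proof
  assume "T i c \<le> v"
  then have "{..c} \<subseteq> {c. c < \<alpha> i \<and> T i c \<le> v}"
    using semistandardD(3)[OF T _ c] c by (auto intro: order_trans)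
  then have "card {..c} \<le> pattern_of \<alpha> T i v" unfolding pattern_of_def by (intro card_mono) auto
  then show "c < pattern_of \<alpha> T i v" by simp
next
  assume less: "c < pattern_of \<alpha> T i v"
  show "T i c \<le> v"
  proof (rule ccontr)
    assume "\<not> T i c \<le> v"
    then have "d < c" if "d < \<alpha> i" "T i d \<le> v" for d
      using semistandardD(3)[OF T, of c d i] that by (cases "d < c") auto
    then have "{c. c < \<alpha> i \<and> T i c \<le> v} \<subseteq> {..<c}" by auto
    then have "pattern_of \<alpha> T i v \<le> card {..<c}" unfolding pattern_of_def by (intro card_mono) auto
    then show False using less by simp
  qed
qed

lemma gt_pattern_pattern_of:
  assumes T: "semistandard \<alpha> T" and \<alpha>: "antimono \<alpha>" and m: "\<And>i c. c < \<alpha> i \<Longrightarrow> T i c \<le> m"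
  shows "gt_pattern m \<alpha> (pattern_of \<alpha> T)"
  unfolding gt_pattern_def
proof (intro conjI allI impI)
  fix i v
  have "{c. c < \<alpha> i \<and> T i c \<le> 0} = {}" using semistandardD(1)[OF T, of _ i] by force
  then show "pattern_of \<alpha> T i 0 = 0" unfolding pattern_of_def by simp
  show "pattern_of \<alpha> T i v \<le> pattern_of \<alpha> T i (Suc v)"
    unfolding pattern_of_def by (intro card_mono) auto
  have "c < \<alpha> i \<and> T i c \<le> v" if "c < \<alpha> (Suc i)" "T (Suc i) c \<le> Suc v" for c
  proof -
    have "\<alpha> (Suc i) \<le> \<alpha> i" using \<alpha> by (simp add: antimonoD)
    then have "c < \<alpha> i" using that by simp
    then show ?thesis using semistandardD(4)[OF T, of i "Suc i" c] that by simp
  qed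
  then show "pattern_of \<alpha> T (Suc i) (Suc v) \<le> pattern_of \<alpha> T i v"
    unfolding pattern_of_def by (intro card_mono) auto
  assume "m \<le> v"
  then have "{c. c < \<alpha> i \<and> T i c \<le> v} = {..<\<alpha> i}" using m by (auto intro: order_trans)
  then show "pattern_of \<alpha> T i v = \<alpha> i" unfolding pattern_of_def by simp
qed

text \<open>The counterpart of \<open>less_pattern_of_iff\<close> for patterns. Level
  \<open>m\<close>, where the row is complete, guarantees that the \<open>LEAST\<close>
  exists.\<close>

lemma tableau_of_le_iff:
  assumes g: "gt_pattern m \<alpha> g" and c: "c < \<alpha> i"
  shows "tableau_of \<alpha> g i c \<le> v \<longleftrightarrow> c < g i v"
proof
  assume "c < g i v"
  then show "tableau_of \<alpha> g i c \<le> v" using c unfolding tableau_of_def by (simp add: Least_le)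
next
  assume le: "tableau_of \<alpha> g i c \<le> v"
  have "c < g i m" using g c unfolding gt_pattern_def by simp
  then have "c < g i (tableau_of \<alpha> g i c)" using c unfolding tableau_of_def by (auto intro: LeastI)
  also have "\<dots> \<le> g i v" by (rule gt_pattern_mono[OF g le])
  finally show "c < g i v" .
qed

lemma semistandard_tableau_of:
  assumes g: "gt_pattern m \<alpha> g"
  shows "semistandard \<alpha> (tableau_of \<alpha> g)"
proof -
  note iff = tableau_of_le_iff[OF g]
  have "1 \<le> tableau_of \<alpha> g i c" if "c < \<alpha> i" for i c
    using iff[OF that, of 0] g unfolding gt_pattern_def by simp
  moreover have "tableau_of \<alpha> g i c = 0" if "\<not> c < \<alpha> i" for i c
    using that unfolding tableau_of_def by simp
  moreover have "tableau_of \<alpha> g i c \<le> tableau_of \<alpha> g i d" if "c < d" "c < \<alpha> i" "d < \<alpha> i" for i c d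
    using iff[OF that(2)] iff[OF that(3), of "tableau_of \<alpha> g i d"] that by simp
  moreover have "tableau_of \<alpha> g i c < tableau_of \<alpha> g j c" if "i < j" "c < \<alpha> i" "c < \<alpha> j" for i j c
  proof -
    \<comment> \<open>Going back \<open>d\<close> steps along the diagonal from row \<open>j\<close>
      at level \<open>w\<close> reaches row \<open>i\<close> at level \<open>w - d\<close>;
      \<open>j < w\<close> excludes truncation.\<close>
    define w d where "w = tableau_of \<alpha> g j c" and "d = j - i"
    have gw: "c < g j w" using iff[OF that(3), of w] unfolding w_def by simp
    then have "j < w" using gt_pattern_eq_0[OF g, of w j] by (metis not_less not_less_zero)
    then have "g j w \<le> g i (w - d)" using gt_pattern_diagonal[OF g, of i d "w - d"] that(1) unfolding d_def by simp
    then have "tableau_of \<alpha> g i c \<le> w - d" using iff[OF that(2)] gw by simp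
    then show ?thesis using \<open>j < w\<close> that(1) unfolding d_def w_def by linarith
  qed
  ultimately show ?thesis unfolding semistandard_def diagram_def by auto
qed

lemma pattern_of_tableau_of:
  assumes g: "gt_pattern m \<alpha> g"
  shows "pattern_of \<alpha> (tableau_of \<alpha> g) = g"
proof (intro ext)
  fix i v
  have "{c. c < \<alpha> i \<and> tableau_of \<alpha> g i c \<le> v} = {..<g i v}"
    using tableau_of_le_iff[OF g] gt_pattern_le[OF g, of i v] by auto
  then show "pattern_of \<alpha> (tableau_of \<alpha> g) i v = g i v" unfolding pattern_of_def by simp
qed

lemma tableau_of_pattern_of:
  assumes T: "semistandard \<alpha> T"
  shows "tableau_of \<alpha> (pattern_of \<alpha> T) = T"
proof (intro ext)
  fix i c
  show "tableau_of \<alpha> (pattern_of \<alpha> T) i c = T i c"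
  proof (cases "c < \<alpha> i")
    case True
    then show ?thesis
      unfolding tableau_of_def less_pattern_of_iff[OF T True] by (auto intro: Least_equality)
  next
    case False
    then show ?thesis using semistandardD(2)[OF T] unfolding tableau_of_def by simp
  qed
qed

section \<open>Weights and prefix sums of patterns\<close>

lemma finite_diagram:
  assumes "is_partition \<alpha>"
  shows "finite (diagram \<alpha>)"
proof -
  have "diagram \<alpha> \<subseteq> {i. \<alpha> i \<noteq> 0} \<times> {..<\<alpha> 0}"
    using assms unfolding diagram_def is_partition_def by (auto intro: less_le_trans antimonoD)
  then show ?thesis using assms unfolding is_partition_def by (auto intro: finite_subset)
qed

text \<open>Both sides count the cells with entry at most \<open>v\<close>, by letter and by row.
  Position \<open>u\<close> of the weight stands for the letter \<open>u + 1\<close>, and rows from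
  \<open>v\<close> on contain no such cell.\<close>

lemma sum_weight:
  assumes \<alpha>: "is_partition \<alpha>" and T: "semistandard \<alpha> T" and g: "gt_pattern m \<alpha> (pattern_of \<alpha> T)"
  shows "(\<Sum>u<v. weight \<alpha> T u) = (\<Sum>i<v. pattern_of \<alpha> T i v)"
proof -
  have "(\<Sum>u<v. weight \<alpha> T u) = card {(a, c) \<in> diagram \<alpha>. T a c \<le> v}"
  proof (induction v)
    case 0
    have "{(a, c) \<in> diagram \<alpha>. T a c \<le> 0} = {}"
      using semistandardD(1)[OF T] unfolding diagram_def by force
    then show ?case by (metis card.empty lessThan_0 sum.empty)
  next
    case (Suc v)
    have "{(a, c) \<in> diagram \<alpha>. T a c \<le> Suc v}
        = {(a, c) \<in> diagram \<alpha>. T a c \<le> v} \<union> {(a, c) \<in> diagram \<alpha>. T a c = v + 1}" by auto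
    moreover have "finite {(a, c) \<in> diagram \<alpha>. P a c}" for P
      by (rule finite_subset[OF _ finite_diagram[OF \<alpha>]]) auto
    ultimately have "card {(a, c) \<in> diagram \<alpha>. T a c \<le> Suc v}
        = card {(a, c) \<in> diagram \<alpha>. T a c \<le> v} + card {(a, c) \<in> diagram \<alpha>. T a c = v + 1}"
      by (simp only:) (rule card_Un_disjoint, auto)
    then show ?case using Suc unfolding weight_def by simp
  qed
  also have "{(a, c) \<in> diagram \<alpha>. T a c \<le> v} = (SIGMA a:{..<v}. {c. c < \<alpha> a \<and> T a c \<le> v})"
  proof -
    have "a < v" if "c < \<alpha> a" "T a c \<le> v" for a c
      using less_pattern_of_iff[OF T that(1), of v] gt_pattern_eq_0[OF g, of v a] that
      by (metis not_less not_less_zero)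
    then show ?thesis unfolding diagram_def by auto
  qed
  also have "card \<dots> = (\<Sum>i<v. pattern_of \<alpha> T i v)" unfolding pattern_of_def by simp
  finally show ?thesis .
qed

context
  fixes \<Lambda> :: "(nat \<Rightarrow> nat) list" and \<mu> :: "nat \<Rightarrow> nat" and m :: nat
  assumes \<Lambda>: "\<And>j. j < length \<Lambda> \<Longrightarrow> is_partition (\<Lambda> ! j)" and \<mu>: "\<And>i. m \<le> i \<Longrightarrow> \<mu> i = 0"
begin

lemma multi_pattern_pattern_of:
  assumes Ts: "Ts \<in> multitableaux \<Lambda> \<mu>"
  shows "multi_pattern (length \<Lambda>) m ((!) \<Lambda>) \<mu> (\<lambda>j. pattern_of (\<Lambda> ! j) (Ts ! j))"
proof -
  have ss: "semistandard (\<Lambda> ! j) (Ts ! j)" if "j < length \<Lambda>" for j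
    using Ts that unfolding multitableaux_def by simp
  have wt: "\<mu> i = (\<Sum>j<length \<Lambda>. weight (\<Lambda> ! j) (Ts ! j) i)" for i
    using Ts unfolding multitableaux_def by blast
  have gt: "gt_pattern m (\<Lambda> ! j) (pattern_of (\<Lambda> ! j) (Ts ! j))" if j: "j < length \<Lambda>" for j
  proof (rule gt_pattern_pattern_of[OF ss[OF j]])
    show "antimono (\<Lambda> ! j)" using \<Lambda>[OF j] unfolding is_partition_def by simp
    fix i c assume c: "c < (\<Lambda> ! j) i"
    show "(Ts ! j) i c \<le> m"
    proof (rule ccontr)
      assume big: "\<not> (Ts ! j) i c \<le> m"
      \<comment> \<open>The position of the offending letter in the weight; it is at least
        \<open>m\<close>, where \<open>\<mu>\<close> vanishes.\<close>
      define u where "u = (Ts ! j) i c - 1"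
      have u: "m \<le> u" "(Ts ! j) i c = u + 1" using big unfolding u_def by auto
      have "weight (\<Lambda> ! j) (Ts ! j) u = 0" using \<mu>[OF u(1)] wt[of u] j by simp
      moreover have "finite {(a, c) \<in> diagram (\<Lambda> ! j). (Ts ! j) a c = u + 1}"
        by (rule finite_subset[OF _ finite_diagram[OF \<Lambda>[OF j]]]) auto
      ultimately have "{(a, c) \<in> diagram (\<Lambda> ! j). (Ts ! j) a c = u + 1} = {}"
        unfolding weight_def by simp
      then show False using c u(2) unfolding diagram_def by blast
    qed
  qed
  have "psum (length \<Lambda>) (\<lambda>j i. pattern_of (\<Lambda> ! j) (Ts ! j) i v) v = (\<Sum>i<v. \<mu> i)" for v
  proof -
    have "psum (length \<Lambda>) (\<lambda>j i. pattern_of (\<Lambda> ! j) (Ts ! j) i v) v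
        = (\<Sum>j<length \<Lambda>. \<Sum>i<v. pattern_of (\<Lambda> ! j) (Ts ! j) i v)"
      unfolding psum_def by (rule sum.swap)
    also have "\<dots> = (\<Sum>j<length \<Lambda>. \<Sum>u<v. weight (\<Lambda> ! j) (Ts ! j) u)"
      using sum_weight[OF \<Lambda> ss gt] by (metis (no_types, lifting) lessThan_iff sum.cong)
    also have "\<dots> = (\<Sum>i<v. \<mu> i)" unfolding wt by (rule sum.swap)
    finally show ?thesis .
  qed
  then show ?thesis using gt unfolding multi_pattern_def by blast
qed

lemma multitableaux_tableau_of:
  assumes G: "multi_pattern (length \<Lambda>) m ((!) \<Lambda>) \<mu> G"
  shows "map (\<lambda>j. tableau_of (\<Lambda> ! j) (G j)) [0..<length \<Lambda>] \<in> multitableaux \<Lambda> \<mu>"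
proof -
  let ?T = "\<lambda>j. tableau_of (\<Lambda> ! j) (G j)"
  have gt: "gt_pattern m (\<Lambda> ! j) (G j)" if "j < length \<Lambda>" for j
    using G that unfolding multi_pattern_def by simp
  note ss = semistandard_tableau_of[OF gt]
  have cumulative: "(\<Sum>u<v. \<Sum>j<length \<Lambda>. weight (\<Lambda> ! j) (?T j) u) = (\<Sum>i<v. \<mu> i)" if "v \<le> m" for v
  proof -
    have "(\<Sum>u<v. \<Sum>j<length \<Lambda>. weight (\<Lambda> ! j) (?T j) u) = (\<Sum>j<length \<Lambda>. \<Sum>u<v. weight (\<Lambda> ! j) (?T j) u)"
      by (rule sum.swap)
    also have "\<dots> = (\<Sum>j<length \<Lambda>. \<Sum>i<v. G j i v)"
    proof (rule sum.cong[OF refl])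
      fix j assume "j \<in> {..<length \<Lambda>}"
      then show "(\<Sum>u<v. weight (\<Lambda> ! j) (?T j) u) = (\<Sum>i<v. G j i v)"
        using sum_weight[OF \<Lambda> ss, of j m v] gt by (simp add: pattern_of_tableau_of[OF gt])
    qed
    also have "\<dots> = psum (length \<Lambda>) (\<lambda>j i. G j i v) v" unfolding psum_def by (rule sum.swap)
    finally show ?thesis using G that unfolding multi_pattern_def by simp
  qed
  \<comment> \<open>Below \<open>m\<close> the weight is the difference of consecutive cumulative
    counts; from \<open>m\<close> on, both sides vanish because no entry exceeds
    \<open>m\<close>.\<close>
  have "\<mu> i = (\<Sum>j<length \<Lambda>. weight (\<Lambda> ! j) (?T j) i)" for i
  proof (cases "i < m")
    case True
    then show ?thesis using cumulative[of i] cumulative[of "Suc i"] by simp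
  next
    case False
    have "weight (\<Lambda> ! j) (?T j) i = 0" if j: "j < length \<Lambda>" for j
    proof -
      have "?T j a c \<le> m" if "c < (\<Lambda> ! j) a" for a c
        using tableau_of_le_iff[OF gt[OF j] that, of m] gt[OF j] that unfolding gt_pattern_def by simp
      then have "{(a, c) \<in> diagram (\<Lambda> ! j). ?T j a c = i + 1} = {}"
        using False unfolding diagram_def by force
      then show ?thesis unfolding weight_def by (simp only: card.empty)
    qed
    then show ?thesis using \<mu> False by simp
  qed
  then show ?thesis using ss unfolding multitableaux_def by simp
qed

text \<open>\<open>pattern_of\<close> and \<open>tableau_of\<close> are inverse to each other, so
  existence and uniqueness pass in both directions.\<close>

lemma multi_kostka_eq_1_iff:
  "multi_kostka \<Lambda> \<mu> = 1 \<longleftrightarrow>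
     (\<exists>G. multi_pattern (length \<Lambda>) m ((!) \<Lambda>) \<mu> G) \<and> unique_pattern (length \<Lambda>) m ((!) \<Lambda>) \<mu>"
proof
  assume "multi_kostka \<Lambda> \<mu> = 1"
  then obtain Ts where Ts: "multitableaux \<Lambda> \<mu> = {Ts}"
    unfolding multi_kostka_def by (metis card_1_singletonE)
  have "unique_pattern (length \<Lambda>) m ((!) \<Lambda>) \<mu>"
    unfolding unique_pattern_def
  proof (intro allI impI)
    fix G H j
    assume G: "multi_pattern (length \<Lambda>) m ((!) \<Lambda>) \<mu> G" and H: "multi_pattern (length \<Lambda>) m ((!) \<Lambda>) \<mu> H"
      and j: "j < length \<Lambda>"
    have "map (\<lambda>j. tableau_of (\<Lambda> ! j) (G j)) [0..<length \<Lambda>] = map (\<lambda>j. tableau_of (\<Lambda> ! j) (H j)) [0..<length \<Lambda>]"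
      using multitableaux_tableau_of[OF G] multitableaux_tableau_of[OF H] unfolding Ts by simp
    then have "tableau_of (\<Lambda> ! j) (G j) = tableau_of (\<Lambda> ! j) (H j)" using j by simp
    then show "G j = H j"
      using G H j pattern_of_tableau_of unfolding multi_pattern_def by metis
  qed
  then show "(\<exists>G. multi_pattern (length \<Lambda>) m ((!) \<Lambda>) \<mu> G) \<and> unique_pattern (length \<Lambda>) m ((!) \<Lambda>) \<mu>"
    using multi_pattern_pattern_of[of Ts] Ts by blast
next
  assume asm: "(\<exists>G. multi_pattern (length \<Lambda>) m ((!) \<Lambda>) \<mu> G) \<and> unique_pattern (length \<Lambda>) m ((!) \<Lambda>) \<mu>"
  then obtain Ts where Ts: "Ts \<in> multitableaux \<Lambda> \<mu>" using multitableaux_tableau_of by blast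
  have "Us = Ts" if Us: "Us \<in> multitableaux \<Lambda> \<mu>" for Us
  proof (rule nth_equalityI)
    show len: "length Us = length Ts" using Ts Us unfolding multitableaux_def by simp
    fix j assume "j < length Us"
    then have j: "j < length \<Lambda>" using Us unfolding multitableaux_def by simp
    then have "pattern_of (\<Lambda> ! j) (Us ! j) = pattern_of (\<Lambda> ! j) (Ts ! j)"
      using asm multi_pattern_pattern_of[OF Ts] multi_pattern_pattern_of[OF Us]
      unfolding unique_pattern_def by blast
    moreover have "semistandard (\<Lambda> ! j) (Us ! j)" "semistandard (\<Lambda> ! j) (Ts ! j)"
      using Us Ts j unfolding multitableaux_def by auto
    ultimately show "Us ! j = Ts ! j" using tableau_of_pattern_of by metis
  qed
  then have "multitableaux \<Lambda> \<mu> = {Ts}" using Ts by blast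
  then show "multi_kostka \<Lambda> \<mu> = 1" unfolding multi_kostka_def by simp
qed

end

subsection \<open>The criterion\<close>

lemma psize_eq_sum:
  assumes "\<And>i. N \<le> i \<Longrightarrow> \<alpha> i = 0"
  shows "psize \<alpha> = (\<Sum>i<N. \<alpha> i)"
proof -
  have "i < N" if "\<alpha> i \<noteq> 0" for i using assms[of i] that by (cases "i < N") auto
  then have "{i. \<alpha> i \<noteq> 0} \<subseteq> {..<N}" by auto
  then show ?thesis unfolding psize_def by (intro sum.mono_neutral_left) auto
qed

lemma is_partition_support:
  assumes "is_partition \<alpha>"
  shows "{i. \<alpha> i \<noteq> 0} = {..<plength \<alpha>}"
proof -
  have fin: "finite {i. \<alpha> i \<noteq> 0}" and an: "antimono \<alpha>" using assms unfolding is_partition_def by auto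
  have down: "{..i} \<subseteq> {i. \<alpha> i \<noteq> 0}" if "\<alpha> i \<noteq> 0" for i
  proof
    fix k assume "k \<in> {..i}"
    then have "\<alpha> i \<le> \<alpha> k" using an by (simp add: antimonoD)
    then show "k \<in> {i. \<alpha> i \<noteq> 0}" using that by simp
  qed
  have "i < plength \<alpha>" if "\<alpha> i \<noteq> 0" for i
    using card_mono[OF fin down[OF that]] unfolding plength_def by simp
  then have "{i. \<alpha> i \<noteq> 0} \<subseteq> {..<plength \<alpha>}" by auto
  then show ?thesis using card_subset_eq[of "{..<plength \<alpha>}"] by (simp add: plength_def)
qed

lemma is_partition_eq_0:
  assumes "is_partition \<alpha>" "plength \<alpha> \<le> i"
  shows "\<alpha> i = 0"
proof (rule ccontr)
  assume "\<alpha> i \<noteq> 0"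
  then have "i \<in> {..<plength \<alpha>}" using is_partition_support[OF assms(1)] by blast
  then show False using assms(2) by simp
qed

text \<open>Equality at \<open>p\<close> cancels everything before the block, so condition (1)
  becomes a condition on the global prefix sums between \<open>p\<close> and
  \<open>q\<close>.\<close>

lemma dominates_blocks_iff:
  assumes pq: "p \<le> q" and eq: "psum (length \<Lambda>) ((!) \<Lambda>) p = (\<Sum>i<p. \<mu> i)"
  shows "sum_parts (map (block p q) \<Lambda>) \<unrhd> block p q \<mu> \<longleftrightarrow>
    psum (length \<Lambda>) ((!) \<Lambda>) q = (\<Sum>i<q. \<mu> i) \<and>
    (\<forall>k\<in>{p..q}. (\<Sum>i<k. \<mu> i) \<le> psum (length \<Lambda>) ((!) \<Lambda>) k)"
proof -
  define S where "S = sum_parts (map (block p q) \<Lambda>)"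
  have S: "S i = (\<Sum>j<length \<Lambda>. block p q (\<Lambda> ! j) i)" for i
    unfolding S_def sum_parts_def by simp
  have S0: "S i = 0" "block p q \<mu> i = 0" if "q - p \<le> i" for i
    using that unfolding S block_def by auto
  have prefix: "psum (length \<Lambda>) ((!) \<Lambda>) p + (\<Sum>i<k. S i) = psum (length \<Lambda>) ((!) \<Lambda>) (p + k)" if "p + k \<le> q" for k
    using psum_block[OF that, of "length \<Lambda>" "(!) \<Lambda>"] unfolding S psum_def[of _ "\<lambda>j. block p q (\<Lambda> ! j)"] .
  \<comment> \<open>Both sequences vanish from \<open>q - p\<close> on, so longer prefixes add no
    condition.\<close>
  have cut: "(\<Sum>i<k. S i) = (\<Sum>i<min k (q - p). S i)"
    "(\<Sum>i<k. block p q \<mu> i) = (\<Sum>i<min k (q - p). block p q \<mu> i)" for k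
    using S0 by (intro sum.mono_neutral_right; auto)+
  have "(\<forall>k. (\<Sum>i<k. block p q \<mu> i) \<le> (\<Sum>i<k. S i)) \<longleftrightarrow>
      (\<forall>k\<le>q - p. (\<Sum>i<k. block p q \<mu> i) \<le> (\<Sum>i<k. S i))"
    using cut by (metis min.cobounded2)
  also have "\<dots> \<longleftrightarrow> (\<forall>k\<le>q - p. (\<Sum>i<p + k. \<mu> i) \<le> psum (length \<Lambda>) ((!) \<Lambda>) (p + k))"
  proof -
    have "(\<Sum>i<k. block p q \<mu> i) \<le> (\<Sum>i<k. S i) \<longleftrightarrow> (\<Sum>i<p + k. \<mu> i) \<le> psum (length \<Lambda>) ((!) \<Lambda>) (p + k)"
      if "k \<le> q - p" for k
    proof -
      have "p + k \<le> q" using that pq by simp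
      then show ?thesis using prefix[of k] sum_block[of p k q \<mu>] eq by linarith
    qed
    then show ?thesis by blast
  qed
  also have "\<dots> \<longleftrightarrow> (\<forall>k\<in>{p..q}. (\<Sum>i<k. \<mu> i) \<le> psum (length \<Lambda>) ((!) \<Lambda>) k)"
  proof -
    have "{p..q} = (\<lambda>k. p + k) ` {..q - p}"
      using pq by (simp add: atMost_atLeast0)
    then show ?thesis unfolding \<open>{p..q} = _\<close> by auto
  qed
  finally have 1: "(\<forall>k. (\<Sum>i<k. block p q \<mu> i) \<le> (\<Sum>i<k. S i)) \<longleftrightarrow>
      (\<forall>k\<in>{p..q}. (\<Sum>i<k. \<mu> i) \<le> psum (length \<Lambda>) ((!) \<Lambda>) k)" .
  have "psize S = psize (block p q \<mu>) \<longleftrightarrow> psum (length \<Lambda>) ((!) \<Lambda>) q = (\<Sum>i<q. \<mu> i)"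
    using psize_eq_sum[of "q - p" S] psize_eq_sum[of "q - p" "block p q \<mu>"] S0
      prefix[of "q - p"] sum_block[of p "q - p" q \<mu>] eq pq by auto
  then show ?thesis using 1 unfolding dominates_def S_def[symmetric] by simp
qed

section \<open>Condition (2) in terms of equal rows\<close>

lemma all_equalI:
  assumes "\<And>i. p \<le> i \<Longrightarrow> Suc i < q \<Longrightarrow> \<alpha> i = \<alpha> (Suc i)"
  shows "all_equal p q \<alpha>"
proof -
  have "i < q \<Longrightarrow> \<alpha> i = \<alpha> p" if "p \<le> i" for i
    using that by (induction i rule: dec_induct) (use assms in auto)
  then show ?thesis unfolding all_equal_def by (meson atLeastLessThan_iff)
qed

lemma all_equalD:
  assumes "all_equal p q \<alpha>" "p \<le> i" "i < q" "p \<le> k" "k < q"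
  shows "\<alpha> i = \<alpha> k"
proof -
  have "\<alpha> i = \<alpha> p" "\<alpha> k = \<alpha> p" using assms unfolding all_equal_def by (meson atLeastLessThan_iff)+
  then show ?thesis by simp
qed

lemma all_equal_no_jump:
  assumes "all_equal p q \<alpha>"
  shows "\<not> last_smaller p q \<alpha>" "\<not> first_larger p q \<alpha>"
proof -
  have "\<alpha> (q - 2) = \<alpha> (q - 1) \<and> \<alpha> p = \<alpha> (p + 1)" if "p + 2 \<le> q"
    using all_equalD[OF assms, of "q - 2" "q - 1"] all_equalD[OF assms, of p "p + 1"] that by simp
  then show "\<not> last_smaller p q \<alpha>" "\<not> first_larger p q \<alpha>"
    unfolding last_smaller_def first_larger_def by (metis less_irrefl)+
qed

text \<open>A constant component has neither kind of jump, so all jumps sit at a single index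
  \<open>j0\<close>, which is arbitrary when there are none.\<close>

lemma at_most_one_jump_iff:
  "at_most_one_jump p q \<Lambda> \<longleftrightarrow>
     (\<exists>j0. \<forall>j<length \<Lambda>. all_equal p q (\<Lambda> ! j) \<or>
        j = j0 \<and> (last_smaller p q (\<Lambda> ! j) \<or> first_larger p q (\<Lambda> ! j)))"
proof -
  define J where "J = {j. j < length \<Lambda> \<and> (last_smaller p q (\<Lambda> ! j) \<or> first_larger p q (\<Lambda> ! j))}"
  have "finite J" unfolding J_def by simp
  then have "card J \<le> 1 \<longleftrightarrow> (\<forall>x\<in>J. \<forall>y\<in>J. x = y)" by (simp add: card_le_Suc0_iff_eq)
  also have "\<dots> \<longleftrightarrow> (\<exists>j0. \<forall>j\<in>J. j = j0)" by metis
  finally have "at_most_one_jump p q \<Lambda> \<longleftrightarrow>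
      (\<exists>j0. \<forall>j\<in>J. j = j0) \<and> (\<forall>j<length \<Lambda>. j \<notin> J \<longrightarrow> all_equal p q (\<Lambda> ! j))"
    unfolding at_most_one_jump_def Let_def J_def[symmetric] by simp
  also have "\<dots> \<longleftrightarrow> (\<exists>j0. \<forall>j<length \<Lambda>. all_equal p q (\<Lambda> ! j) \<or>
        j = j0 \<and> (last_smaller p q (\<Lambda> ! j) \<or> first_larger p q (\<Lambda> ! j)))"
    using all_equal_no_jump unfolding J_def mem_Collect_eq Ball_def by blast
  finally show ?thesis .
qed

text \<open>Rows \<open>i\<close> and \<open>i + (q - v)\<close> straddle a drop before the last row
  only for \<open>i = v - 1\<close>, and a drop after the first row only for
  \<open>i = p\<close>.\<close>

lemma at_most_one_jump_rigid:
  assumes jump: "at_most_one_jump p q \<Lambda>" and v: "p < v" "v < q"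
  shows "\<exists>j0 i0. \<forall>j<length \<Lambda>. \<forall>i. p \<le> i \<and> i < v \<and> (j, i) \<noteq> (j0, i0)
           \<longrightarrow> (\<Lambda> ! j) (i + (q - v)) = (\<Lambda> ! j) i"
proof -
  obtain j0 where j0: "\<And>j. j < length \<Lambda> \<Longrightarrow> all_equal p q (\<Lambda> ! j) \<or>
        j = j0 \<and> (last_smaller p q (\<Lambda> ! j) \<or> first_larger p q (\<Lambda> ! j))"
    using jump unfolding at_most_one_jump_iff by blast
  define i0 where "i0 = (if last_smaller p q (\<Lambda> ! j0) then v - 1 else p)"
  have "(\<Lambda> ! j) (i + (q - v)) = (\<Lambda> ! j) i"
    if j: "j < length \<Lambda>" and i: "p \<le> i" "i < v" and ne: "(j, i) \<noteq> (j0, i0)" for j i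
  proof -
    consider "all_equal p q (\<Lambda> ! j)" | "j = j0" "last_smaller p q (\<Lambda> ! j)"
      | "j = j0" "\<not> last_smaller p q (\<Lambda> ! j)" "first_larger p q (\<Lambda> ! j)" using j0[OF j] by blast
    then show ?thesis
    proof cases
      case 1
      then show ?thesis by (rule all_equalD) (use i v in auto)
    next
      case 2
      then have "i < v - 1" using ne i unfolding i0_def by auto
      have "all_equal p (q - 1) (\<Lambda> ! j)" using 2 unfolding last_smaller_def by simp
      then show ?thesis by (rule all_equalD) (use \<open>i < v - 1\<close> i v in auto)
    next
      case 3
      then have "p < i" using ne i unfolding i0_def by auto
      have "all_equal (p + 1) q (\<Lambda> ! j)" using 3 unfolding first_larger_def by simp
      then show ?thesis by (rule all_equalD) (use \<open>p < i\<close> i v in auto)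
    qed
  qed
  then show ?thesis by blast
qed

text \<open>Lists the elements of \<open>Z\<close> up to \<open>z\<close> in order: a chain to the
  predecessor of \<open>z\<close> in \<open>Z\<close> is prolonged by \<open>z\<close>.\<close>

lemma consecutive_chain:
  fixes Z :: "nat set"
  assumes "0 \<in> Z"
  shows "z \<in> Z \<Longrightarrow> \<exists>t \<iota>. \<iota> 0 = 0 \<and> \<iota> t = z \<and>
    (\<forall>k<t. \<iota> k \<in> Z \<and> \<iota> (Suc k) \<in> Z \<and> \<iota> k < \<iota> (Suc k) \<and> (\<forall>x. \<iota> k < x \<and> x < \<iota> (Suc k) \<longrightarrow> x \<notin> Z))"
proof (induction z rule: less_induct)
  case (less z)
  show ?case
  proof (cases "z = 0")
    case True
    then show ?thesis by (intro exI[of _ 0] exI[of _ "\<lambda>_. 0"]) simp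
  next
    case False
    define y where "y = Max {x \<in> Z. x < z}"
    have fin: "finite {x \<in> Z. x < z}" by simp
    have "{x \<in> Z. x < z} \<noteq> {}" using False assms by auto
    then have y: "y \<in> Z" "y < z" using Max_in[OF fin] unfolding y_def by blast+
    have gap: "x \<notin> Z" if "y < x" "x < z" for x
    proof
      assume "x \<in> Z"
      then have "x \<le> y" using that(2) unfolding y_def by (intro Max_ge[OF fin]) simp
      then show False using that(1) by simp
    qed
    obtain t \<iota> where \<iota>: "\<iota> 0 = 0" "\<iota> t = y" and step: "\<forall>k<t. \<iota> k \<in> Z \<and> \<iota> (Suc k) \<in> Z \<and> \<iota> k < \<iota> (Suc k) \<and>
        (\<forall>x. \<iota> k < x \<and> x < \<iota> (Suc k) \<longrightarrow> x \<notin> Z)"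
      using less.IH[OF y(2,1)] by blast
    show ?thesis
      by (rule exI[of _ "Suc t"], rule exI[of _ "\<iota>(Suc t := z)"])
        (use \<iota> step y gap less.prems in \<open>auto simp: less_Suc_eq\<close>)
  qed
qed

lemma interval_of_chain:
  fixes \<iota> :: "nat \<Rightarrow> nat"
  assumes "\<iota> 0 = 0"
  shows "i < \<iota> t \<Longrightarrow> \<exists>k<t. \<iota> k \<le> i \<and> i < \<iota> (Suc k)"
proof (induction t)
  case (Suc t)
  then show ?case by (cases "i < \<iota> t") (auto simp: not_less intro: less_SucI)
qed (simp add: assms)

text \<open>A block of at least two rows without an inner cut is strictly dominating and inherits
  uniqueness, so \<open>strictly_dominating_single_jump\<close> applies: a drop at its start is
  \<open>first_larger\<close>, one at its end is \<open>last_smaller\<close>.\<close>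

lemma unique_pattern_at_most_one_jump:
  assumes u: "unique_pattern (length \<Lambda>) l ((!) \<Lambda>) \<mu>" and G: "multi_pattern (length \<Lambda>) l ((!) \<Lambda>) \<mu> G"
    and A: "\<And>j. j < length \<Lambda> \<Longrightarrow> antimono (\<Lambda> ! j)" and mu: "antimono \<mu>"
    and pq: "p < q" "q \<le> l"
    and eqp: "psum (length \<Lambda>) ((!) \<Lambda>) p = (\<Sum>i<p. \<mu> i)"
    and eqq: "psum (length \<Lambda>) ((!) \<Lambda>) q = (\<Sum>i<q. \<mu> i)"
    and strict: "\<And>k. p < k \<Longrightarrow> k < q \<Longrightarrow> psum (length \<Lambda>) ((!) \<Lambda>) k \<noteq> (\<Sum>i<k. \<mu> i)"
  shows "at_most_one_jump p q \<Lambda>"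
proof (cases "q = Suc p")
  case True
  then show ?thesis unfolding at_most_one_jump_iff all_equal_def by auto
next
  case False
  define m where "m = q - p - 1"
  have m: "q - p = Suc m" "0 < m" "q = Suc (p + m)" using pq False unfolding m_def by auto
  let ?B = "\<lambda>j. block p q (\<Lambda> ! j)"
  have dom: "dominating (length \<Lambda>) l ((!) \<Lambda>) \<mu>" using multi_pattern_imp_dominating[OF G A] .
  have anti: "antimono (block p q \<alpha>)" if "antimono \<alpha>" for \<alpha>
    using that unfolding block_def by (auto simp: antimono_iff_le_Suc)
  have prefix: "psum (length \<Lambda>) ((!) \<Lambda>) (p + k) = psum (length \<Lambda>) ((!) \<Lambda>) p + psum (length \<Lambda>) ?B k"
    "(\<Sum>i<p + k. \<mu> i) = (\<Sum>i<p. \<mu> i) + (\<Sum>i<k. block p q \<mu> i)" if "k \<le> Suc m" for k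
    using psum_block[of p k q "length \<Lambda>" "(!) \<Lambda>"] sum_block[of p k q \<mu>] that m by auto
  have le: "(\<Sum>i<k. \<mu> i) \<le> psum (length \<Lambda>) ((!) \<Lambda>) k" if "k \<le> l" for k
    using dom that unfolding dominating_def by simp
  have strict_block: "strictly_dominating (length \<Lambda>) (Suc m) ?B (block p q \<mu>)"
    unfolding strictly_dominating_def dominating_def
  proof (intro conjI allI impI)
    fix k
    show "(\<Sum>i<k. block p q \<mu> i) \<le> psum (length \<Lambda>) ?B k" if "k \<le> Suc m"
      using le[of "p + k"] prefix[OF that] eqp that m pq by simp
    show "(\<Sum>i<k. block p q \<mu> i) < psum (length \<Lambda>) ?B k" if "0 < k \<and> k < Suc m"
      using le[of "p + k"] strict[of "p + k"] prefix[of k] eqp that m pq by simp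
    show "psum (length \<Lambda>) ?B (Suc m) = (\<Sum>i<Suc m. block p q \<mu> i)"
      using prefix[of "Suc m"] eqp eqq m by simp
  next
    fix j i assume "j < length \<Lambda>"
    then show "antimono (?B j)" using anti A by blast
    show "?B j i = 0" if "Suc m \<le> i" using that m unfolding block_def by simp
  qed
  have unique_block: "unique_pattern (length \<Lambda>) (Suc m) ?B (block p q \<mu>)"
    using unique_pattern_block[OF u G A pq eqp eqq] unfolding m(1) .
  obtain j0 a where j0: "j0 < length \<Lambda>" "a = 0 \<or> Suc a = m" "?B j0 (Suc a) < ?B j0 a"
    and flat: "\<And>j i. \<lbrakk>j < length \<Lambda>; i < m; (j, i) \<noteq> (j0, a)\<rbrakk> \<Longrightarrow> ?B j i = ?B j (Suc i)"
    using strictly_dominating_single_jump[OF unique_block strict_block anti[OF mu] m(2)] by blast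
  have flat': "(\<Lambda> ! j) i = (\<Lambda> ! j) (Suc i)"
    if "j < length \<Lambda>" "p \<le> i" "Suc i < q" "(j, i) \<noteq> (j0, p + a)" for j i
  proof -
    have "i - p < m" "(j, i - p) \<noteq> (j0, a)" using that m by auto
    then show ?thesis using flat[of j "i - p"] that m by (simp add: block_def)
  qed
  have am: "a < m" using j0(2) m(2) by auto
  then have jump: "(\<Lambda> ! j0) (Suc (p + a)) < (\<Lambda> ! j0) (p + a)" using j0(3) m by (simp add: block_def)
  have "all_equal p q (\<Lambda> ! j)" if "j < length \<Lambda>" "j \<noteq> j0" for j
    by (rule all_equalI) (use flat'[OF that(1)] that(2) in auto)
  moreover have "first_larger p q (\<Lambda> ! j0)" if "a = 0"
  proof -
    have "all_equal (p + 1) q (\<Lambda> ! j0)" by (rule all_equalI) (use flat'[OF j0(1)] that in auto)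
    then show ?thesis using jump that m unfolding first_larger_def by simp
  qed
  moreover have "last_smaller p q (\<Lambda> ! j0)" if "Suc a = m"
  proof -
    have "all_equal p (q - 1) (\<Lambda> ! j0)" by (rule all_equalI) (use flat'[OF j0(1)] that m in auto)
    moreover have "q - 2 = p + a" "q - 1 = Suc (p + a)" using that m by auto
    ultimately show ?thesis using jump m unfolding last_smaller_def by simp
  qed
  ultimately show ?thesis using j0(2) unfolding at_most_one_jump_iff by blast
qed

theorem theorem5p1:
  fixes r n l :: nat and \<Lambda> :: "(nat \<Rightarrow> nat) list" and \<mu> :: "nat \<Rightarrow> nat"
  assumes "r \<ge> 1"
    and "length \<Lambda> = r"
    and "is_multipartition n \<Lambda>"
    and "is_partition \<mu>"
    and "psize \<mu> = n"
    and "plength \<mu> = l"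
  shows "multi_kostka \<Lambda> \<mu> = 1 \<longleftrightarrow>
    (\<exists>(t :: nat) (\<iota> :: nat \<Rightarrow> nat).
       \<iota> 0 = 0 \<and> \<iota> t = l \<and> (\<forall>k < t. \<iota> k < \<iota> (Suc k)) \<and>
       (\<forall>k < t.
          sum_parts (map (block (\<iota> k) (\<iota> (Suc k))) \<Lambda>) \<unrhd> block (\<iota> k) (\<iota> (Suc k)) \<mu> \<and>
          at_most_one_jump (\<iota> k) (\<iota> (Suc k)) \<Lambda>))"
proof -
  let ?r = "length \<Lambda>" and ?A = "(!) \<Lambda>"
  have part: "is_partition (\<Lambda> ! j)" if "j < ?r" for j
    using assms(3) that unfolding is_multipartition_def by simp
  have A: "antimono (\<Lambda> ! j)" if "j < ?r" for j using part[OF that] unfolding is_partition_def by simp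
  have mu: "antimono \<mu>" using assms(4) unfolding is_partition_def by simp
  have mu0: "\<mu> i = 0" if "l \<le> i" for i using is_partition_eq_0[OF assms(4)] assms(6) that by simp
  have M: "(\<Sum>i<l. \<mu> i) = n" using psize_eq_sum[of l \<mu>] mu0 assms(5) by simp
  note kostka = multi_kostka_eq_1_iff[of \<Lambda> l \<mu>, OF part mu0]
  show ?thesis
  proof
    assume "multi_kostka \<Lambda> \<mu> = 1"
    then obtain G where G: "multi_pattern ?r l ?A \<mu> G" and u: "unique_pattern ?r l ?A \<mu>"
      using kostka by blast
    have dom: "dominating ?r l ?A \<mu>" using multi_pattern_imp_dominating[OF G A] .
    \<comment> \<open>Every position with equal prefix sums becomes a cut, which leaves strict
      inequalities inside the blocks.\<close>
    define Z where "Z = {k. k \<le> l \<and> psum ?r ?A k = (\<Sum>i<k. \<mu> i)}"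
    have "0 \<in> Z" "l \<in> Z" using dom unfolding Z_def dominating_def by auto
    then obtain t \<iota> where \<iota>: "\<iota> 0 = 0" "\<iota> t = l" and step: "\<And>k. k < t \<Longrightarrow> \<iota> k \<in> Z \<and> \<iota> (Suc k) \<in> Z \<and> \<iota> k < \<iota> (Suc k) \<and>
        (\<forall>x. \<iota> k < x \<and> x < \<iota> (Suc k) \<longrightarrow> x \<notin> Z)"
      using consecutive_chain[of Z l] by metis
    have "sum_parts (map (block (\<iota> k) (\<iota> (Suc k))) \<Lambda>) \<unrhd> block (\<iota> k) (\<iota> (Suc k)) \<mu> \<and>
          at_most_one_jump (\<iota> k) (\<iota> (Suc k)) \<Lambda>" if "k < t" for k
    proof
      let ?p = "\<iota> k" and ?q = "\<iota> (Suc k)"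
      have pq: "?p < ?q" "?q \<le> l" and eq: "psum ?r ?A ?p = (\<Sum>i<?p. \<mu> i)" "psum ?r ?A ?q = (\<Sum>i<?q. \<mu> i)"
        using step[OF that] unfolding Z_def by auto
      have "(\<Sum>i<k. \<mu> i) \<le> psum ?r ?A k" if "k \<le> l" for k
        using dom that unfolding dominating_def by simp
      then show "sum_parts (map (block ?p ?q) \<Lambda>) \<unrhd> block ?p ?q \<mu>"
        using dominates_blocks_iff[OF _ eq(1), of ?q] eq(2) pq by simp
      have "psum ?r ?A x \<noteq> (\<Sum>i<x. \<mu> i)" if "?p < x" "x < ?q" for x
        using step[OF \<open>k < t\<close>] that pq unfolding Z_def by auto
      then show "at_most_one_jump ?p ?q \<Lambda>"
        using unique_pattern_at_most_one_jump[OF u G A mu pq eq] by blast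
    qed
    then show "\<exists>t \<iota>. \<iota> 0 = 0 \<and> \<iota> t = l \<and> (\<forall>k<t. \<iota> k < \<iota> (Suc k)) \<and>
       (\<forall>k<t. sum_parts (map (block (\<iota> k) (\<iota> (Suc k))) \<Lambda>) \<unrhd> block (\<iota> k) (\<iota> (Suc k)) \<mu> \<and>
          at_most_one_jump (\<iota> k) (\<iota> (Suc k)) \<Lambda>)"
      using \<iota> step by blast
  next
    assume "\<exists>t \<iota>. \<iota> 0 = 0 \<and> \<iota> t = l \<and> (\<forall>k<t. \<iota> k < \<iota> (Suc k)) \<and>
       (\<forall>k<t. sum_parts (map (block (\<iota> k) (\<iota> (Suc k))) \<Lambda>) \<unrhd> block (\<iota> k) (\<iota> (Suc k)) \<mu> \<and>
          at_most_one_jump (\<iota> k) (\<iota> (Suc k)) \<Lambda>)"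
    then obtain t \<iota> where \<iota>: "\<iota> 0 = 0" "\<iota> t = l" and inc: "\<And>k. k < t \<Longrightarrow> \<iota> k < \<iota> (Suc k)"
      and dominates: "\<And>k. k < t \<Longrightarrow> sum_parts (map (block (\<iota> k) (\<iota> (Suc k))) \<Lambda>) \<unrhd> block (\<iota> k) (\<iota> (Suc k)) \<mu>"
      and jump: "\<And>k. k < t \<Longrightarrow> at_most_one_jump (\<iota> k) (\<iota> (Suc k)) \<Lambda>"
      by blast
    \<comment> \<open>Equality at the end of a block is what allows
      \<open>dominates_blocks_iff\<close> to be applied to the next one.\<close>
    have prefix: "psum ?r ?A (\<iota> k) = (\<Sum>i<\<iota> k. \<mu> i) \<and> (\<forall>k'\<le>\<iota> k. (\<Sum>i<k'. \<mu> i) \<le> psum ?r ?A k')" if "k \<le> t" for k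
      using that
    proof (induction k)
      case 0
      then show ?case using \<iota>(1) by simp
    next
      case (Suc k)
      then have k: "k < t" "psum ?r ?A (\<iota> k) = (\<Sum>i<\<iota> k. \<mu> i)" by auto
      have "\<iota> k \<le> \<iota> (Suc k)" using inc[OF k(1)] by simp
      from dominates_blocks_iff[OF this k(2)] dominates[OF k(1)] Suc show ?case
        by (metis Suc_leD atLeastAtMost_iff nle_le)
    qed
    have le_l: "\<iota> k \<le> l" if "k \<le> t" for k
      using that inc \<iota>(2) by (induction rule: inc_induct) (auto intro: less_imp_le order_trans)
    have eql: "psum ?r ?A l = (\<Sum>i<l. \<mu> i)" and le: "\<forall>k\<le>l. (\<Sum>i<k. \<mu> i) \<le> psum ?r ?A k"
      using prefix[of t] \<iota>(2) by auto
    \<comment> \<open>The first \<open>l\<close> rows already contain all \<open>n\<close> boxes.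
      Below, \<open>N\<close> exceeds \<open>i\<close> and bounds every length, so the first
      \<open>N\<close> rows hold all boxes, and the truncation \<open>?B\<close> of the shape after
      row \<open>l\<close> holds equally many.\<close>
    have A0: "(\<Lambda> ! j) i = 0" if j: "j < ?r" and i: "l \<le> i" for j i
    proof (rule ccontr)
      assume pos: "(\<Lambda> ! j) i \<noteq> 0"
      define N where "N = Suc (i + (\<Sum>j<?r. plength (\<Lambda> ! j)))"
      have N: "plength (\<Lambda> ! j) \<le> N" if "j < ?r" for j
        using member_le_sum[of j "{..<?r}" "\<lambda>j. plength (\<Lambda> ! j)"] that unfolding N_def by simp
      have "psum ?r ?A N = (\<Sum>j<?r. \<Sum>i<N. (\<Lambda> ! j) i)" unfolding psum_def by (rule sum.swap)
      also have "\<dots> = (\<Sum>j<?r. psize (\<Lambda> ! j))"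
        using is_partition_eq_0[OF part] N by (intro sum.cong refl psize_eq_sum[symmetric]) (meson lessThan_iff order_trans)
      also have "\<dots> = n"
        using assms(3) unfolding is_multipartition_def
        by (simp add: sum_list_sum_nth atLeast0LessThan)
      finally have N_n: "psum ?r ?A N = n" .
      let ?B = "\<lambda>j i. if i < l then (\<Lambda> ! j) i else 0"
      have "psum ?r ?A l = psum ?r ?B l" by (intro psum_cong) simp
      also have "\<dots> \<le> psum ?r ?B N"
        unfolding psum_def using i N_def by (intro sum_mono2) auto
      finally have "psum ?r ?A N \<le> psum ?r ?B N" using N_n eql M by simp
      then have "?B j i = (\<Lambda> ! j) i" using j N_def by (intro psum_eq_imp_eq[of ?r N ?B]) auto
      then show False using pos i by simp
    qed
    have "dominating ?r l ?A \<mu>" using A A0 le eql unfolding dominating_def by simp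
    then have "\<exists>G. multi_pattern ?r l ?A \<mu> G" by (rule multi_pattern_exists[OF mu])
    moreover have "unique_pattern ?r l ?A \<mu>"
      unfolding unique_pattern_def
    proof (intro allI impI ext)
      fix G H j i v
      assume G: "multi_pattern ?r l ?A \<mu> G" and H: "multi_pattern ?r l ?A \<mu> H" and j: "j < ?r"
      show "G j i v = H j i v"
      proof (cases "i < l")
        case True
        then obtain k where k: "k < t" "\<iota> k \<le> i" "i < \<iota> (Suc k)"
          using interval_of_chain[of \<iota> i t, OF \<iota>(1)] \<iota>(2) by blast
        show ?thesis
          using multi_pattern_eq_block[OF G H inc[OF k(1)] le_l _ _ _ j k(2,3)] prefix[of k] prefix[of "Suc k"]
            at_most_one_jump_rigid[OF jump[OF k(1)]] k(1) by simp
      next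
        case False
        then have "(\<Lambda> ! j) i = 0" using A0[OF j] by simp
        moreover have "G j i v \<le> (\<Lambda> ! j) i" "H j i v \<le> (\<Lambda> ! j) i"
          using G H j gt_pattern_le unfolding multi_pattern_def by blast+
        ultimately show ?thesis by simp
      qed
    qed
    ultimately show "multi_kostka \<Lambda> \<mu> = 1" using kostka by blast
  qed
qed

end
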